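(* Let $d\geq3$ and $2\leq k\leq d-1$. Let $\Omega\subset\mathbb{R}^d$ be a bounded domain with $C^2$ boundary which is star-shaped with respect to the origin, with outer unit normal $\nu$. Suppose that for some $c<0$ and some $\alpha>d$ there is a $k$-convex function $u\in C^2(\mathbb{R}^d\setminus\Omega)$ with $\sigma_k(\lambda(D^2u))=\binom dk$ in $\mathbb{R}^d\setminus\bar\Omega$, $u=0$ and $\partial u/\partial\nu=1$ on $\partial\Omega$, and $$\limsup_{|x|\to\infty}|x|^\alpha\Big|u(x)-\Big(\tfrac12|x|^2+c\Big)\Big|<\infty.$$ Then $\Omega$ is the unit ball centered at the origin and $u(x)=\frac12|x|^2-\frac12$.
   Context: $\sigma_j$ is the $j$-th elementary symmetric function, $\lambda(D^2u)$ the eigenvalues of the Hessian. $\Gamma_k=\{\lambda\in\mathbb{R}^d:\sigma_j(\lambda)>0,\ j=1,\dots,k\}$; $u$ is $k$-convex if $\lambda(D^2u)\in\Gamma_k$ in $\mathbb{R}^d\setminus\bar\Omega$. *)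

theory Defs
  imports "HOL-Analysis.Analysis"
begin

definition esym :: "nat \<Rightarrow> real^'n \<Rightarrow> real" where
  "esym j l = (\<Sum>S\<in>{S::'n set. card S = j}. \<Prod>i\<in>S. l $ i)"

definition Gamma_cone :: "nat \<Rightarrow> (real^'n) set" where
  "Gamma_cone k = {l. \<forall>j\<in>{1..k}. esym j l > 0}"

definition diag_mat :: "real^'n \<Rightarrow> real^'n^'n" where
  "diag_mat l = (\<chi> i j. if i = j then l $ i else 0)"

text \<open>A vector of eigenvalues (with multiplicity) of a symmetric real matrix:
  A = Q diag(l) Q^T with Q orthogonal.  The order is irrelevant for the
  symmetric functions esym.\<close>
definition eigvals :: "real^'n^'n \<Rightarrow> real^'n" where
  "eigvals A = (SOME l. \<exists>Q. orthogonal_matrix Q \<and> A = Q ** diag_mat l ** transpose Q)"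

text \<open>u is C^2 on the (possibly closed) set S, up to the boundary of S:
  gradient g and Hessian H exist as derivatives within S, H continuous on S.\<close>
definition C2_on_with :: "(real^'n) set \<Rightarrow> (real^'n \<Rightarrow> real) \<Rightarrow> (real^'n \<Rightarrow> real^'n)
     \<Rightarrow> (real^'n \<Rightarrow> real^'n^'n) \<Rightarrow> bool" where
  "C2_on_with S u g H \<longleftrightarrow>
     (\<forall>x\<in>S. (u has_derivative (\<lambda>h. g x \<bullet> h)) (at x within S)) \<and>
     (\<forall>x\<in>S. (g has_derivative (\<lambda>h. H x *v h)) (at x within S)) \<and>
     continuous_on S H"

definition C2_boundary_outer_normal :: "(real^'n) set \<Rightarrow> (real^'n \<Rightarrow> real^'n) \<Rightarrow> bool" where
  "C2_boundary_outer_normal \<Omega> \<nu> \<longleftrightarrow>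
     (\<forall>p\<in>frontier \<Omega>. \<exists>r>0. \<exists>\<phi> g H.
        C2_on_with (ball p r) \<phi> g H \<and>
        (\<forall>x\<in>ball p r. g x \<noteq> 0) \<and>
        (\<forall>x\<in>ball p r. x \<in> \<Omega> \<longleftrightarrow> \<phi> x < 0) \<and>
        \<nu> p = (1 / norm (g p)) *\<^sub>R g p)"

end

theory Submission
  imports Defs "HOL-Computational_Algebra.Fundamental_Theorem_Algebra"
begin

text \<open>Put $w = u - (|x|^2/2 + c)$, so that $w = O(|x|^{-\alpha})$ with $\alpha > d$, and use
  $|x|^{-d}$ as a barrier. At an interior maximum of $w + \delta |x|^{-d}$ the Laplacian of $u$ would be
  less than $d$, against the Maclaurin inequality in $\Gamma_k$; at an interior minimum of
  $w - \delta |x|^{-d}$ the Hessian of $u$ would dominate a positive matrix with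
  $\sigma_k > \binom dk$. Hence both functions obey the maximum principle, $w$ lies between its
  extreme boundary values, and these cannot have the same strict sign, as $w$ would otherwise not
  decay faster than $|x|^{-d}$. On the boundary $w = -|x|^2/2 - c$, so the maximum of $w$ is at the
  boundary point $x_0$ nearest to the origin and the minimum at the farthest one $x_1$. The signs of
  the normal derivative $1 - x \cdot \nu$ of $w$ there give $|x_1| \le 1 \le |x_0|$.\<close>

subsection \<open>Symmetric matrices and Hessians\<close>

text \<open>An interior maximum of w alone gives only D^2 u <= I, which the equation permits, so a
  strict barrier is needed. The Laplacian of |x|^(-m) is m (m + 2 - d) |x|^(-m-2), positive once m >
  d - 2, and |x|^(-m) outlasts w at infinity while m < \<alpha>; m = d meets both demands. The
  Hessian of |x|^(-d) is indefinite, with one positive and d - 1 negative eigenvalues, and this is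
  why the two sides differ. From above, the Maclaurin inequality reduces the equation to a trace
  bound, which works for a barrier of any size. From below, the trace is seen only by the linear
  part of \<sigma>_k at (1,...,1), so the barrier must be small enough for its first order gain to
  beat the quadratic error. On both sides only the diagonal of the barrier's Hessian in an
  eigenframe of D^2 u is used, so spectra of sums of matrices never have to be compared.\<close>

lemma hessian_symmetric:
  fixes u :: "real^'n \<Rightarrow> real" and g :: "real^'n \<Rightarrow> real^'n" and H :: "real^'n \<Rightarrow> real^'n^'n"
  assumes S: "open S" "x \<in> S"
    and u: "\<And>y. y \<in> S \<Longrightarrow> (u has_derivative (\<lambda>h. g y \<bullet> h)) (at y)"
    and g: "\<And>y. y \<in> S \<Longrightarrow> (g has_derivative (\<lambda>h. H y *v h)) (at y)"
    and H: "continuous_on S H"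
  shows "transpose (H x) = H x"
proof -
  \<comment> \<open>Schwarz's theorem: this second difference is symmetric in \<open>a\<close> and
    \<open>b\<close>, and the mean value theorem along \<open>a\<close>, then along
    \<open>b\<close>, makes it t^2 times a mixed derivative at a nearby point. Symmetry matters
    because \<open>eigvals\<close> is meaningful only for diagonalizable Hessians.\<close>
  have mean: "\<exists>p \<in> ball x r. u (x + t *\<^sub>R a + t *\<^sub>R b) - u (x + t *\<^sub>R a) - u (x + t *\<^sub>R b) + u x
      = t\<^sup>2 * ((H p *v b) \<bullet> a)"
    if r: "ball x r \<subseteq> S" and t: "0 < t" "t * (norm a + norm b) < r" for r t a b
  proof -
    have near: "x + s *\<^sub>R a + s' *\<^sub>R b \<in> ball x r" if "0 \<le> s" "s \<le> t" "0 \<le> s'" "s' \<le> t" for s s'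
    proof -
      have "norm (s *\<^sub>R a + s' *\<^sub>R b) \<le> s * norm a + s' * norm b"
        using norm_triangle_ineq[of "s *\<^sub>R a" "s' *\<^sub>R b"] that by simp
      also have "\<dots> \<le> t * norm a + t * norm b"
        using that by (intro add_mono mult_right_mono) auto
      also have "\<dots> < r" using t by (simp add: algebra_simps)
      finally show ?thesis
        by (simp add: dist_norm add.assoc) (metis norm_minus_commute minus_diff_eq add_diff_cancel_left' diff_diff_eq norm_minus_cancel uminus_add_conv_diff minus_add_distrib)
    qed
    have du: "((\<lambda>s. u (x + s *\<^sub>R a + s' *\<^sub>R b)) has_real_derivative
        g (x + s *\<^sub>R a + s' *\<^sub>R b) \<bullet> a) (at s)"
      if "0 \<le> s" "s \<le> t" "0 \<le> s'" "s' \<le> t" for s s'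
    proof -
      have "((\<lambda>s. u (x + s *\<^sub>R a + s' *\<^sub>R b)) has_derivative
        (\<lambda>h. g (x + s *\<^sub>R a + s' *\<^sub>R b) \<bullet> (h *\<^sub>R a))) (at s)"
        by (rule has_derivative_compose[where f = "\<lambda>s. x + s *\<^sub>R a + s' *\<^sub>R b", OF _ u])
          (use near[OF that] r in \<open>auto intro!: derivative_eq_intros\<close>)
      then show ?thesis
        by (rule has_derivative_imp_has_field_derivative) simp
    qed
    have "\<exists>\<xi>. 0 < \<xi> \<and> \<xi> < t \<and>
        (u (x + t *\<^sub>R a + t *\<^sub>R b) - u (x + t *\<^sub>R a + 0 *\<^sub>R b))
        - (u (x + 0 *\<^sub>R a + t *\<^sub>R b) - u (x + 0 *\<^sub>R a + 0 *\<^sub>R b))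
        = (t - 0) * (g (x + \<xi> *\<^sub>R a + t *\<^sub>R b) \<bullet> a - g (x + \<xi> *\<^sub>R a + 0 *\<^sub>R b) \<bullet> a)"
      by (rule MVT2[where f = "\<lambda>s. u (x + s *\<^sub>R a + t *\<^sub>R b) - u (x + s *\<^sub>R a + 0 *\<^sub>R b)"])
        (use t in \<open>auto intro!: DERIV_diff du simp del: scaleR_zero_left\<close>)
    then obtain \<xi> where \<xi>: "0 < \<xi>" "\<xi> < t"
      and eq1: "u (x + t *\<^sub>R a + t *\<^sub>R b) - u (x + t *\<^sub>R a) - u (x + t *\<^sub>R b) + u x
        = t * (g (x + \<xi> *\<^sub>R a + t *\<^sub>R b) \<bullet> a - g (x + \<xi> *\<^sub>R a + 0 *\<^sub>R b) \<bullet> a)"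
      by (auto simp: algebra_simps)
    have dg: "((\<lambda>s'. g (x + \<xi> *\<^sub>R a + s' *\<^sub>R b) \<bullet> a) has_real_derivative
        (H (x + \<xi> *\<^sub>R a + s' *\<^sub>R b) *v b) \<bullet> a) (at s')" if "0 \<le> s'" "s' \<le> t" for s'
    proof -
      have "((\<lambda>s'. g (x + \<xi> *\<^sub>R a + s' *\<^sub>R b)) has_derivative
        (\<lambda>h. H (x + \<xi> *\<^sub>R a + s' *\<^sub>R b) *v (h *\<^sub>R b))) (at s')"
        by (rule has_derivative_compose[where f = "\<lambda>s'. x + \<xi> *\<^sub>R a + s' *\<^sub>R b", OF _ g])
          (use near[of \<xi> s'] \<xi> that r in \<open>auto intro!: derivative_eq_intros\<close>)
      then have "((\<lambda>s'. g (x + \<xi> *\<^sub>R a + s' *\<^sub>R b) \<bullet> a) has_derivative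
        (\<lambda>h. (H (x + \<xi> *\<^sub>R a + s' *\<^sub>R b) *v (h *\<^sub>R b)) \<bullet> a)) (at s')"
        by (intro has_derivative_inner_left)
      then show ?thesis
        by (rule has_derivative_imp_has_field_derivative) (simp add: matrix_vector_mult_scaleR)
    qed
    obtain \<eta> where \<eta>: "0 < \<eta>" "\<eta> < t"
      and eq2: "g (x + \<xi> *\<^sub>R a + t *\<^sub>R b) \<bullet> a - g (x + \<xi> *\<^sub>R a + 0 *\<^sub>R b) \<bullet> a
        = (t - 0) * ((H (x + \<xi> *\<^sub>R a + \<eta> *\<^sub>R b) *v b) \<bullet> a)"
      using MVT2[of 0 t "\<lambda>s'. g (x + \<xi> *\<^sub>R a + s' *\<^sub>R b) \<bullet> a"
          "\<lambda>s'. (H (x + \<xi> *\<^sub>R a + s' *\<^sub>R b) *v b) \<bullet> a", OF t(1) dg] by blast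
    show ?thesis
      using near[of \<xi> \<eta>] \<xi> \<eta> unfolding eq1 eq2 power2_eq_square
      by (intro bexI[of _ "x + \<xi> *\<^sub>R a + \<eta> *\<^sub>R b"]) simp_all
  qed
  have sym: "(H x *v b) \<bullet> a = (H x *v a) \<bullet> b" for a b
  proof (rule ccontr)
    let ?D = "\<lambda>a b y. (H y *v b) \<bullet> a"
    \<comment> \<open>Half the discrepancy: two equal values, each within \<open>e\<close> of its
      own limit, cannot have limits \<open>2 * e\<close> apart.\<close>
    define e where "e = \<bar>?D a b x - ?D b a x\<bar> / 2"
    assume "(H x *v b) \<bullet> a \<noteq> (H x *v a) \<bullet> b"
    then have e: "e > 0" by (simp add: e_def)
    have cont: "isCont (?D a b) x" for a b
    proof -
      have "isCont H x" using H S continuous_on_eq_continuous_at by blast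
      then have "isCont (\<lambda>y. \<Sum>i\<in>UNIV. (\<Sum>j\<in>UNIV. H y $ i $ j * b $ j) * a $ i) x"
        unfolding isCont_def by (intro tendsto_intros tendsto_vec_nth)
      then show ?thesis
        by (simp add: matrix_vector_mult_def inner_vec_def)
    qed
    obtain r1 where r1: "r1 > 0" "\<And>y. dist y x < r1 \<Longrightarrow> \<bar>?D a b y - ?D a b x\<bar> < e"
      using cont[of b a] e unfolding continuous_at_eps_delta dist_real_def by metis
    obtain r2 where r2: "r2 > 0" "\<And>y. dist y x < r2 \<Longrightarrow> \<bar>?D b a y - ?D b a x\<bar> < e"
      using cont[of a b] e unfolding continuous_at_eps_delta dist_real_def by metis
    obtain r3 where r3: "r3 > 0" "ball x r3 \<subseteq> S" using S openE by blast
    define r where "r = min (min r1 r2) r3"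
    \<comment> \<open>The summand 1 makes \<open>t * (norm a + norm b) < r\<close> strict.\<close>
    define t where "t = r / (norm a + norm b + 1)"
    have r: "r > 0" "ball x r \<subseteq> S" using r1 r2 r3 by (auto simp: r_def)
    have n: "norm a + norm b + 1 > 0" using norm_ge_zero[of a] norm_ge_zero[of b] by linarith
    have t: "t > 0" using r n by (simp add: t_def)
    have tr: "t * (norm a + norm b) < r"
      using r n by (simp add: t_def pos_divide_less_eq algebra_simps)
    obtain p where p: "p \<in> ball x r" "u (x + t *\<^sub>R a + t *\<^sub>R b) - u (x + t *\<^sub>R a) - u (x + t *\<^sub>R b) + u x
      = t\<^sup>2 * ?D a b p" using mean[OF r(2) t tr] by auto
    obtain q where q: "q \<in> ball x r" "u (x + t *\<^sub>R b + t *\<^sub>R a) - u (x + t *\<^sub>R b) - u (x + t *\<^sub>R a) + u x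
      = t\<^sup>2 * ?D b a q" using mean[OF r(2) t, of b a] tr by (auto simp: add.commute)
    have "t\<^sup>2 * ?D a b p = t\<^sup>2 * ?D b a q"
      using p(2) q(2) by (simp add: algebra_simps)
    then have "?D a b p = ?D b a q" using t by simp
    moreover have "\<bar>?D a b p - ?D a b x\<bar> < e" using p(1) by (intro r1) (simp add: r_def dist_commute)
    moreover have "\<bar>?D b a q - ?D b a x\<bar> < e" using q(1) by (intro r2) (simp add: r_def dist_commute)
    ultimately show False unfolding e_def by argo
  qed
  have "H x $ i $ j = H x $ j $ i" for i j
    using sym[of "axis j 1" "axis i 1"]
    by (simp add: matrix_vector_mul_component inner_axis inner_axis')
  then show ?thesis by (simp add: transpose_def vec_eq_iff)
qed

text \<open>Induction on the dimension: a maximiser of the quadratic form on the unit sphere of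
  \<open>S\<close> is an eigenvector, and self-adjointness makes its orthogonal complement in
  \<open>S\<close> invariant.\<close>

lemma self_adjoint_eigenbasis:
  fixes f :: "'a::euclidean_space \<Rightarrow> 'a"
  assumes f: "linear f" "\<And>x y. x \<bullet> f y = f x \<bullet> y"
    and S: "subspace S" "f ` S \<subseteq> S"
  shows "\<exists>B \<subseteq> S. pairwise orthogonal B \<and> (\<forall>v\<in>B. norm v = 1 \<and> (\<exists>l. f v = l *\<^sub>R v)) \<and> span B = S"
  using S
proof (induction "dim S" arbitrary: S rule: less_induct)
  case less
  show ?case
  proof (cases "S = {0}")
    case True
    then show ?thesis by (intro exI[of _ "{}"]) auto
  next
    case False
    interpret linear f by fact
    obtain s where s: "s \<in> S" "s \<noteq> 0" using False subspace_0[OF less.prems(1)] by blast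
    have comp: "compact (S \<inter> sphere 0 1)"
      using closed_subspace[OF less.prems(1)] by (intro closed_Int_compact) auto
    have "(1 / norm s) *\<^sub>R s \<in> S \<inter> sphere 0 1"
      using s less.prems(1) by (simp add: subspace_scale)
    then have ne: "S \<inter> sphere 0 1 \<noteq> {}" by blast
    have cont: "continuous_on (S \<inter> sphere 0 1) (\<lambda>x. x \<bullet> f x)"
      by (intro continuous_intros linear_continuous_on) (simp add: f(1) linear_conv_bounded_linear[symmetric])
    obtain v where v: "v \<in> S" "norm v = 1" and max: "\<And>y. y \<in> S \<Longrightarrow> norm y = 1 \<Longrightarrow> y \<bullet> f y \<le> v \<bullet> f v"
      using continuous_attains_sup[OF comp ne cont] by auto
    define l where "l = v \<bullet> f v"
    have vv: "v \<bullet> v = 1" using v by (simp add: norm_eq_1)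
    have quad: "y \<bullet> f y \<le> l * (y \<bullet> y)" if "y \<in> S" for y
    proof (cases "y = 0")
      case False
      let ?z = "(1 / norm y) *\<^sub>R y"
      have "?z \<bullet> f ?z \<le> l" using max[of ?z] that False less.prems(1) by (simp add: subspace_scale l_def)
      then show ?thesis using False by (simp add: scale field_simps dot_square_norm power2_eq_square)
    qed (simp add: zero)
    have eig: "f v = l *\<^sub>R v"
    proof -
      define h where "h = f v - l *\<^sub>R v"
      have hS: "h \<in> S" unfolding h_def using v less.prems
        by (intro subspace_diff subspace_scale) auto
      have hh: "h \<bullet> f v - l * (h \<bullet> v) = h \<bullet> h" by (simp add: h_def inner_diff_right inner_diff_left)
      \<comment> \<open>Maximality is tested at v + t h, moved along the residual \<open>h\<close>.
        The gain is linear in \<open>t\<close> and the loss quadratic, so a small positive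
        \<open>t\<close> excludes \<open>h \<noteq> 0\<close>.\<close>
      have key: "2 * t * (h \<bullet> h) \<le> t\<^sup>2 * (l * (h \<bullet> h) - h \<bullet> f h)" for t
      proof -
        have "v + t *\<^sub>R h \<in> S" using v hS less.prems(1) by (intro subspace_add subspace_scale)
        from quad[OF this] have
          "l + 2 * t * (h \<bullet> f v) + t\<^sup>2 * (h \<bullet> f h) \<le> l * (1 + 2 * t * (h \<bullet> v) + t\<^sup>2 * (h \<bullet> h))"
          using f(2)[of v h]
          by (simp add: add scale inner_add_left inner_add_right l_def vv inner_commute algebra_simps power2_eq_square)
        then show ?thesis unfolding hh[symmetric] by (simp only: algebra_simps)
      qed
      define K where "K = \<bar>l * (h \<bullet> h) - h \<bullet> f h\<bar> + 1"
      have K: "K > 0" by (simp add: K_def)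
      have "h \<bullet> h \<le> 0"
      proof (rule ccontr)
        assume "\<not> ?thesis"
        then have pos: "h \<bullet> h > 0" by (simp only: not_le)
        define t where "t = (h \<bullet> h) / K"
        have t: "t > 0" using pos K by (simp add: t_def)
        have "2 * t * (h \<bullet> h) \<le> t\<^sup>2 * K"
          by (rule order_trans[OF key mult_left_mono]) (auto simp: K_def)
        also have "\<dots> = t * (h \<bullet> h)" using K by (simp add: t_def power2_eq_square)
        finally show False using t pos by simp
      qed
      then have "h = 0" using inner_gt_zero_iff[of h] by linarith
      then show ?thesis by (simp add: h_def)
    qed
    define T where "T = S \<inter> {x. v \<bullet> x = 0}"
    have T: "subspace T" unfolding T_def using less.prems(1) subspace_hyperplane by (rule subspace_inter)
    have fT: "f ` T \<subseteq> T"
      using less.prems(2) f(2)[of v] by (auto simp: T_def eig)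
    have "v \<notin> T" using vv by (simp add: T_def)
    then have "T \<subset> S" using v(1) unfolding T_def by blast
    then have "dim T < dim S" using T less.prems(1) dim_psubset[of T S]
      by (metis span_eq_iff)
    from less.hyps[OF this T fT] obtain B where B: "B \<subseteq> T" "pairwise orthogonal B"
      "\<forall>v\<in>B. norm v = 1 \<and> (\<exists>l. f v = l *\<^sub>R v)" "span B = T" by blast
    have "span (insert v B) = S"
    proof
      show "span (insert v B) \<subseteq> S"
        using v B less.prems(1) by (intro span_minimal) (auto simp: T_def)
      show "S \<subseteq> span (insert v B)"
      proof
        fix x assume x: "x \<in> S"
        have "x - (v \<bullet> x) *\<^sub>R v \<in> T"
          using x v less.prems(1) by (simp add: T_def inner_diff_right vv subspace_diff subspace_scale)
        then show "x \<in> span (insert v B)"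
          using B(4) span_insert[of v B] by auto
      qed
    qed
    moreover have "pairwise orthogonal (insert v B)"
      using B by (auto simp: pairwise_insert orthogonal_def T_def inner_commute)
    ultimately show ?thesis
      using v eig B by (intro exI[of _ "insert v B"]) (auto simp: T_def)
  qed
qed

text \<open>Provides the witness for the \<open>SOME\<close> in \<open>eigvals\<close>; the columns
  of \<open>Q\<close> are an orthonormal eigenbasis.\<close>

lemma symmetric_diagonalizable:
  fixes A :: "real^'n^'n"
  assumes "transpose A = A"
  shows "\<exists>l Q. orthogonal_matrix Q \<and> A = Q ** diag_mat l ** transpose Q"
proof -
  have adj: "x \<bullet> (A *v y) = (A *v x) \<bullet> y" for x y
    using assms by (metis dot_lmul_matrix vector_transpose_matrix)
  obtain B where B: "pairwise orthogonal B" "\<And>v. v \<in> B \<Longrightarrow> norm v = 1"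
    "\<And>v. v \<in> B \<Longrightarrow> \<exists>l. A *v v = l *\<^sub>R v" "span B = UNIV"
    using self_adjoint_eigenbasis[of "(*v) A" UNIV] adj by auto
  have "0 \<notin> B" using B(2) by fastforce
  then have ind: "independent B" using B(1) by (rule pairwise_orthogonal_independent[rotated])
  then have card: "card B = CARD('n)"
    using B(4) by (metis dim_UNIV dim_span_eq_card_independent DIM_cart DIM_real mult.right_neutral)
  have "finite B" using ind by (rule independent_imp_finite)
  then obtain e :: "'n \<Rightarrow> real^'n" where e: "bij_betw e UNIV B"
    using finite_same_card_bij[of "UNIV :: 'n set" B] card by auto
  have eB: "e i \<in> B" for i using e by (auto simp: bij_betw_def)
  have "\<forall>i. \<exists>l. A *v e i = l *\<^sub>R e i" using B(3) eB by blast
  then obtain l where l: "\<And>i. A *v e i = l i *\<^sub>R e i" by metis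
  define Q :: "real^'n^'n" where "Q = (\<chi> i j. e j $ i)"
  have col: "column j Q = e j" for j by (simp add: Q_def column_def)
  have Q: "orthogonal_matrix Q"
    unfolding orthogonal_matrix_orthonormal_columns col
    using B(1,2) eB e by (fastforce simp: pairwise_def bij_betw_def inj_on_def)
  have "A ** Q = Q ** diag_mat (\<chi> i. l i)"
    using l by (auto simp: vec_eq_iff matrix_matrix_mult_def matrix_vector_mult_def Q_def diag_mat_def
        if_distrib[where f = "\<lambda>x. _ * x"] cong: if_cong)
  then have "A = Q ** diag_mat (\<chi> i. l i) ** transpose Q"
    using Q by (metis matrix_mul_assoc matrix_mul_rid orthogonal_matrix_def)
  then show ?thesis using Q by blast
qed

text \<open>The form in which eigenvalues are used later: as second derivatives along an orthonormal
  frame. The last clause, Parseval, will make squared direction cosines sum to 1.\<close>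

lemma eigvals_orthonormal:
  fixes A :: "real^'n^'n"
  assumes "transpose A = A"
  obtains q :: "'n \<Rightarrow> real^'n" where "\<And>i. norm (q i) = 1"
    "\<And>i. q i \<bullet> (A *v q i) = eigvals A $ i" "\<And>x. (\<Sum>i\<in>UNIV. (x \<bullet> q i)\<^sup>2) = (norm x)\<^sup>2"
proof -
  have "\<exists>Q. orthogonal_matrix Q \<and> A = Q ** diag_mat (eigvals A) ** transpose Q"
    unfolding eigvals_def by (rule someI_ex) (rule symmetric_diagonalizable[OF assms])
  then obtain Q where Q: "orthogonal_matrix Q" and A: "A = Q ** diag_mat (eigvals A) ** transpose Q"
    by blast
  define l where "l = eigvals A"
  define q where "q i = column i Q" for i
  have tQ: "transpose Q *v x = (\<chi> i. x \<bullet> q i)" for x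
    by (simp add: vec_eq_iff matrix_vector_mult_def transpose_def q_def column_def inner_vec_def mult.commute)
  have n: "norm (q i) = 1" for i using Q by (simp add: q_def orthogonal_matrix_orthonormal_columns)
  have o: "q j \<bullet> q i = (if i = j then 1 else 0)" for i j
    using Q n by (auto simp: q_def orthogonal_matrix_orthonormal_columns orthogonal_def norm_eq_1)
  show ?thesis
  proof
    show "norm (q i) = 1" for i by (rule n)
    have "A *v q i = Q *v (diag_mat l *v (transpose Q *v q i))" for i
      by (subst A) (simp add: matrix_vector_mul_assoc matrix_mul_assoc l_def del: vector_transpose_matrix transpose_matrix_vector)
    moreover have "diag_mat l *v (transpose Q *v q i) = l $ i *\<^sub>R axis i 1" for i
      unfolding tQ by (simp add: vec_eq_iff matrix_vector_mult_def diag_mat_def o axis_def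
          if_distrib[where f = "\<lambda>x. _ * x"] if_distrib[where f = "\<lambda>x. x * _"] cong: if_cong)
    ultimately have "A *v q i = l $ i *\<^sub>R q i" for i
      by (simp add: matrix_vector_mult_scaleR q_def matrix_vector_mult_basis)
    then show "q i \<bullet> (A *v q i) = eigvals A $ i" for i using o[of i i] by (simp add: l_def)
    have "norm (transpose Q *v x) = norm x" for x
      using Q orthogonal_matrix_transpose orthogonal_transformation_matrix
      by (metis matrix_of_matrix_vector_mul orthogonal_transformation_norm matrix_vector_mul_linear)
    then show "(\<Sum>i\<in>UNIV. (x \<bullet> q i)\<^sup>2) = (norm x)\<^sup>2" for x
      unfolding tQ by (metis (mono_tags, lifting) norm_vec_def L2_set_def real_sqrt_pow2 sum_nonneg zero_le_power2 real_norm_def power2_abs vec_lambda_beta sum.cong)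
  qed
qed

subsection \<open>Elementary symmetric functions\<close>

text \<open>At a root z of p' off the real axis, p'/p = \<Sum> 1/(z - r_i) vanishes, although for
  real r_i every summand has an imaginary part of the sign of -Im z. Repeated roots need no separate
  count, as they would with Rolle's theorem.\<close>

lemma real_roots_pderiv:
  fixes p :: "complex poly"
  assumes roots: "\<And>z. poly p z = 0 \<Longrightarrow> Im z = 0" and deg: "degree p > 0"
    and z: "poly (pderiv p) z = 0"
  shows "Im z = 0"
proof (rule ccontr)
  assume nz: "Im z \<noteq> 0"
  obtain r where r: "smult (lead_coeff p) (\<Prod>i<degree p. [:- r i, 1:]) = p"
    using complex_poly_decompose' by blast
  let ?n = "degree p" and ?q = "\<Prod>i<degree p. [:- r i, 1:]"
  have lc: "lead_coeff p \<noteq> 0" using deg by auto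
  have im: "Im (r i) = 0" if "i < ?n" for i
    using that by (intro roots) (subst r[symmetric], auto simp: poly_prod prod_zero_iff)
  have nzi: "z - r i \<noteq> 0" if "i < ?n" for i using im[OF that] nz by auto
  have "0 = poly (pderiv ?q) z"
    using z lc by (subst (asm) r[symmetric]) (simp add: pderiv_smult)
  also have "\<dots> = (\<Sum>i<?n. \<Prod>j\<in>{..<?n} - {i}. z - r j)"
    by (simp add: pderiv_prod poly_sum poly_prod pderiv_pCons)
  also have "\<dots> = (\<Sum>i<?n. (\<Prod>j<?n. z - r j) * inverse (z - r i))"
  proof (rule sum.cong[OF refl])
    fix i assume i: "i \<in> {..<?n}"
    have "(\<Prod>j<?n. z - r j) = (z - r i) * (\<Prod>j\<in>{..<?n} - {i}. z - r j)"
      using i by (intro prod.remove) auto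
    then show "(\<Prod>j\<in>{..<?n} - {i}. z - r j) = (\<Prod>j<?n. z - r j) * inverse (z - r i)"
      using nzi[of i] i by simp
  qed
  also have "\<dots> = (\<Prod>j<?n. z - r j) * (\<Sum>i<?n. inverse (z - r i))"
    by (simp add: sum_distrib_left)
  finally have "(\<Sum>i<?n. inverse (z - r i)) = 0"
    using nzi by (auto simp: prod_zero_iff)
  then have "0 = (\<Sum>i<?n. Im (inverse (z - r i)))" by (metis Im_sum zero_complex.simps(2))
  also have "\<dots> = - Im z * (\<Sum>i<?n. inverse ((cmod (z - r i))\<^sup>2))"
    unfolding sum_distrib_left
    by (intro sum.cong) (simp_all add: im cmod_def divide_inverse)
  finally have "(\<Sum>i<?n. inverse ((cmod (z - r i))\<^sup>2)) = 0" using nz by simp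
  moreover have "(\<Sum>i<?n. inverse ((cmod (z - r i))\<^sup>2)) > 0"
    using deg nzi by (intro sum_pos) auto
  ultimately show False by simp
qed

text \<open>The bound \<open>m \<le> degree p\<close> stops the differentiation before the zero
  polynomial, which has every z as a root.\<close>

lemma real_roots_higher_pderiv:
  fixes p :: "complex poly"
  assumes "\<And>z. poly p z = 0 \<Longrightarrow> Im z = 0" and "m \<le> degree p"
    and "poly ((pderiv ^^ m) p) z = 0"
  shows "Im z = 0"
  using assms(2,3)
proof (induction m arbitrary: z)
  case (Suc m)
  show ?case
  proof (rule real_roots_pderiv[of "(pderiv ^^ m) p"])
    show "Im w = 0" if "poly ((pderiv ^^ m) p) w = 0" for w
      using Suc.IH[OF _ that] Suc.prems(1) by simp
    have "degree ((pderiv ^^ m) p) = degree p - m"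
      by (induction m) (auto simp: degree_pderiv)
    then show "degree ((pderiv ^^ m) p) > 0" using Suc.prems(1) by simp
    show "poly (pderiv ((pderiv ^^ m) p)) z = 0" using Suc.prems(2) by simp
  qed
qed (use assms(1) in simp)

text \<open>Vieta's formula: expand over all subsets and group them by size. The factors t + l_i,
  rather than t - l_i, keep the coefficients free of signs.\<close>

lemma prod_linear_eq_esym:
  fixes l :: "real^'n"
  shows "(\<Prod>i\<in>UNIV. [:of_real (l $ i), 1:]) =
    (\<Sum>j\<le>CARD('n). monom (of_real (esym j l)) (CARD('n) - j) :: complex poly)"
proof -
  have "(\<Prod>i\<in>(UNIV::'n set). [:of_real (l $ i), 1:] :: complex poly) = (\<Prod>i\<in>UNIV. [:of_real (l $ i):] + monom 1 1)"
    by (simp add: monom_altdef)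
  also have "\<dots> = (\<Sum>X\<in>UNIV. (\<Prod>i\<in>X. [:of_real (l $ i):]) * (\<Prod>i\<in>UNIV-X. monom 1 1))"
    by (simp add: prod_add)
  also have "\<dots> = (\<Sum>X\<in>UNIV. monom (of_real (\<Prod>i\<in>X. l $ i)) (CARD('n) - card X))"
  proof (rule sum.cong[OF refl])
    fix X :: "'n set"
    have "(\<Prod>i\<in>X. [:of_real (l $ i):]) = [:complex_of_real (\<Prod>i\<in>X. l $ i):]"
      by (induction X rule: infinite_finite_induct) (auto simp: one_pCons)
    then show "(\<Prod>i\<in>X. [:of_real (l $ i):]) * (\<Prod>i\<in>UNIV-X. monom 1 1)
      = (monom (of_real (\<Prod>i\<in>X. l $ i)) (CARD('n) - card X) :: complex poly)"
      by (simp add: card_Diff_subset monom_power smult_monom flip: of_real_prod)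
  qed
  also have "\<dots> = (\<Sum>j\<le>CARD('n). \<Sum>X\<in>{X::'n set. card X = j}. monom (of_real (\<Prod>i\<in>X. l $ i)) (CARD('n) - card X))"
    by (rule sum.group[symmetric, of UNIV "{..CARD('n)}" card, simplified]) (auto intro: card_mono)
  also have "\<dots> = (\<Sum>j\<le>CARD('n). monom (of_real (esym j l)) (CARD('n) - j))"
    by (simp add: esym_def monom_sum)
  finally show ?thesis .
qed

lemma coeff_prod_linear:
  fixes l :: "real^'n"
  assumes "j \<le> CARD('n)"
  shows "coeff (\<Prod>i\<in>UNIV. [:of_real (l $ i), 1:]) (CARD('n) - j) = complex_of_real (esym j l)"
proof -
  have "coeff (\<Prod>i\<in>UNIV. [:of_real (l $ i), 1:]) (CARD('n) - j)
    = (\<Sum>i\<le>CARD('n). if i = j then complex_of_real (esym i l) else 0)"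
    unfolding prod_linear_eq_esym coeff_sum coeff_monom
    using assms by (intro sum.cong) (auto simp: )
  then show ?thesis using assms by simp
qed

section \<open>Maclaurin inequality between \<sigma>_k and \<sigma>_1\<close>

lemma sum_ge_card_if_prod_eq_1:
  fixes s :: "'a \<Rightarrow> real"
  assumes "finite I" "\<And>i. i \<in> I \<Longrightarrow> s i > 0" "prod s I = 1"
  shows "sum s I \<ge> card I"
proof -
  \<comment> \<open>The arithmetic-geometric mean inequality in normalised form, from ln s <= s -
    1.\<close>
  have "0 = ln (prod s I)" using assms by simp
  also have "\<dots> = (\<Sum>i\<in>I. ln (s i))" using assms by (intro ln_prod) force+
  also have "\<dots> \<le> (\<Sum>i\<in>I. s i - 1)" using assms by (intro sum_mono ln_le_minus_one) auto
  finally show ?thesis by (simp add: sum_subtractf)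
qed

lemma coeff_prod_monic_linear:
  fixes s :: "nat \<Rightarrow> 'a::comm_ring_1"
  shows "coeff (\<Prod>i<n. [:s i, 1:]) n = 1" "coeff (\<Prod>i<n. [:s i, 1:]) 0 = (\<Prod>i<n. s i)"
    "coeff (\<Prod>i<Suc n. [:s i, 1:]) n = (\<Sum>i<Suc n. s i)"
proof -
  have hi: "m > n \<Longrightarrow> coeff (\<Prod>i<n. [:s i, 1:]) m = 0" for m n
    by (induction n arbitrary: m) (auto simp: coeff_pCons split: nat.split)
  show top: "coeff (\<Prod>i<n. [:s i, 1:]) n = 1" for n
    by (induction n) (auto simp: coeff_pCons hi)
  show "coeff (\<Prod>i<n. [:s i, 1:]) 0 = (\<Prod>i<n. s i)"
    by (induction n) auto
  show "coeff (\<Prod>i<Suc n. [:s i, 1:]) n = (\<Sum>i<Suc n. s i)"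
  proof (induction n)
    case (Suc n)
    then show ?case
      by (subst prod.lessThan_Suc) (simp add: top del: prod.lessThan_Suc)
  qed simp
qed

text \<open>The $(d-k)$-th derivative of $\prod_i (t + l_i)$ has real roots $-s_1, \dots, -s_k$, and on the
  cone its coefficients are positive, so that all $s_i > 0$.  Up to normalisation, $\prod s_i$ is
  $\sigma_k$ and $\sum s_i$ is $\sigma_1$.\<close>
lemma maclaurin_Gamma_cone:
  fixes l :: "real^'n"
  assumes k: "1 \<le> k" "k \<le> CARD('n)" and cone: "l \<in> Gamma_cone k"
    and eq: "esym k l = real (CARD('n) choose k)"
  shows "(\<Sum>i\<in>UNIV. l $ i) \<ge> CARD('n)"
proof -
  define d where "d = CARD('n)"
  define p where "p = (\<Prod>i\<in>UNIV. [:complex_of_real (l $ i), 1:])"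
  define q where "q = (pderiv ^^ (d - k)) p"
  have kd: "k \<le> d" using k by (simp add: d_def)
  have e0: "esym 0 l = 1"
  proof -
    have "{S::'n set. card S = 0} = {{}}" by auto
    then show ?thesis by (simp add: esym_def)
  qed
  have e1: "esym 1 l = (\<Sum>i\<in>UNIV. l $ i)"
  proof -
    have "{S::'n set. card S = 1} = (\<lambda>i. {i}) ` UNIV" by (auto simp: card_1_singleton_iff)
    then show ?thesis by (simp add: esym_def sum.reindex)
  qed
  \<comment> \<open>The coefficient of t^(k-j) in \<open>q\<close>: differentiating t^(d-j) exactly
    d - k times produces the quotient of factorials.\<close>
  define f where "f j = fact (d - j) / fact (k - j) * esym j l" for j
  have fpos: "f j > 0" if "j \<le> k" for j
    using cone that e0 by (cases "j = 0") (auto simp: f_def Gamma_cone_def)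
  have cq: "coeff q (k - j) = complex_of_real (f j)" if "j \<le> k" for j
  proof -
    have "coeff q (k - j) = pochhammer (of_nat (Suc (k - j))) (d - k) * coeff p (d - j)"
      using that kd by (simp add: q_def coeff_higher_pderiv)
    also have "coeff p (d - j) = complex_of_real (esym j l)"
      unfolding p_def d_def using that kd d_def by (intro coeff_prod_linear) auto
    also have "pochhammer (of_nat (Suc (k - j))) (d - k) = complex_of_real (fact (d - j) / fact (k - j))"
    proof -
      have "fact (d - j) = (fact (k - j) * pochhammer (of_nat (Suc (k - j))) (d - k) :: complex)"
        using pochhammer_product'[of "1::complex" "k - j" "d - k"] that kd
        by (simp add: pochhammer_fact)
      then show ?thesis by simp
    qed
    finally show ?thesis by (simp add: f_def)
  qed
  have degp: "degree p = d"
    unfolding p_def d_def by (subst degree_prod_eq_sum_degree) auto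
  have degq: "degree q = k"
  proof -
    have "degree ((pderiv ^^ m) p) = degree p - m" for m
      by (induction m) (auto simp: degree_pderiv)
    then show ?thesis using degp kd by (simp add: q_def)
  qed
  have real: "Im z = 0" if "poly q z = 0" for z
  proof (rule real_roots_higher_pderiv[of p "d - k"])
    show "Im w = 0" if "poly p w = 0" for w
      using that unfolding p_def by (auto simp: poly_prod add_eq_0_iff)
    show "d - k \<le> degree p" by (simp add: degp)
    show "poly ((pderiv ^^ (d - k)) p) z = 0" using that by (simp add: q_def)
  qed
  obtain r where r: "smult (lead_coeff q) (\<Prod>i<k. [:- r i, 1:]) = q"
    using complex_poly_decompose'[of q] degq by metis
  have lc: "lead_coeff q = complex_of_real (f 0)" using cq[of 0] degq by simp
  have root: "poly q (r i) = 0" if "i < k" for i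
    using that by (subst r[symmetric]) (auto simp: poly_prod prod_zero_iff)
  define s where "s i = - Re (r i)" for i
  have rs: "r i = complex_of_real (- s i)" if "i < k" for i
    using real[OF root[OF that]] by (simp add: s_def complex_eq_iff)
  have spos: "s i > 0" if i: "i < k" for i
  proof (rule ccontr)
    assume "\<not> ?thesis"
    then have t: "- s i \<ge> 0" by simp
    have "poly q (complex_of_real (- s i)) = (\<Sum>j\<le>k. complex_of_real (f (k - j)) * complex_of_real (- s i) ^ j)"
      unfolding poly_altdef degq
    proof (rule sum.cong[OF refl])
      fix j assume "j \<in> {..k}"
      then have "coeff q j = complex_of_real (f (k - j))" using cq[of "k - j"] by simp
      then show "coeff q j * complex_of_real (- s i) ^ j = complex_of_real (f (k - j)) * complex_of_real (- s i) ^ j"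
        by (simp only:)
    qed
    also have "\<dots> = complex_of_real (\<Sum>j\<le>k. f (k - j) * (- s i) ^ j)" by simp
    finally have "(\<Sum>j\<le>k. f (k - j) * (- s i) ^ j) = 0"
      using root[OF i] unfolding rs[OF i] by (metis of_real_eq_0_iff)
    \<comment> \<open>At a nonnegative argument all terms are nonnegative, and the constant term
      \<open>f k\<close> is positive.\<close>
    moreover have "(\<Sum>j\<le>k. f (k - j) * (- s i) ^ j) > 0"
      using t fpos by (intro sum_pos2[of _ 0]) (auto intro!: mult_nonneg_nonneg simp: less_imp_le)
    ultimately show False by simp
  qed
  have q: "q = smult (complex_of_real (f 0)) (\<Prod>i<k. [:complex_of_real (s i), 1:])"
  proof -
    have "(\<Prod>i<k. [:- r i, 1:]) = (\<Prod>i<k. [:complex_of_real (s i), 1:])"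
      using rs by (intro prod.cong) auto
    then show ?thesis using r lc by simp
  qed
  have "complex_of_real (f k) = complex_of_real (f 0 * (\<Prod>i<k. s i))"
    using cq[of k] by (simp add: q coeff_prod_monic_linear)
  then have "f k = f 0 * (\<Prod>i<k. s i)" using of_real_eq_iff by blast
  \<comment> \<open>Both equal d!/k!. The normalisation of the equation by the binomial coefficient
    is what makes the product of the \<open>s i\<close> equal to 1.\<close>
  moreover have "f k = f 0"
    using kd by (simp add: f_def e0 eq binomial_fact flip: d_def)
  ultimately have prod1: "(\<Prod>i<k. s i) = 1" using fpos[of 0] by simp
  obtain k' where k': "k = Suc k'" using k by (cases k) auto
  have "complex_of_real (f 1) = complex_of_real (f 0 * (\<Sum>i<k. s i))"
    using cq[of 1] k coeff_prod_monic_linear(3)[of "\<lambda>i. complex_of_real (s i)" k']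
    by (simp add: q k' del: sum.lessThan_Suc prod.lessThan_Suc)
  then have f1: "f 1 = f 0 * (\<Sum>i<k. s i)" using of_real_eq_iff by blast
  \<comment> \<open>Common factor of the two leading coefficients: cancelling it leaves \<sigma>_1 =
    (d/k) \<Sum> s_i, which is at least d.\<close>
  define F where "F = (fact (d - 1) / fact (k - 1) :: real)"
  have "f 0 = F * (d / k)"
    using k kd by (simp add: f_def F_def e0 fact_reduce[of d] fact_reduce[of k] mult.commute)
  moreover have "f 1 = F * esym 1 l" by (simp add: f_def F_def)
  ultimately have "F * esym 1 l = F * (d / k * (\<Sum>i<k. s i))"
    using f1 by (simp only: mult.assoc)
  moreover have "F \<noteq> 0" by (simp add: F_def)
  ultimately have "esym 1 l = d / k * (\<Sum>i<k. s i)" by (metis mult_cancel_left)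
  moreover have "real k \<le> (\<Sum>i<k. s i)"
    using sum_ge_card_if_prod_eq_1[of "{..<k}" s] spos prod1 by (metis card_lessThan finite_lessThan lessThan_iff)
  then have "d / k * real k \<le> d / k * (\<Sum>i<k. s i)" by (rule mult_left_mono) simp
  moreover have "d / k * real k = d" using k by simp
  ultimately show ?thesis unfolding e1 d_def by linarith
qed

section \<open>Growth of \<sigma>_k under a perturbation of (1,...,1)\<close>

lemma prod_shift_ge:
  fixes c :: real
  assumes "finite S" "c \<ge> 0" "\<And>i. i \<in> S \<Longrightarrow> z i \<ge> 0"
  shows "c ^ card S + c ^ (card S - 1) * (\<Sum>i\<in>S. z i) \<le> (\<Prod>i\<in>S. c + z i)"
  using assms(1,3)
proof (induction S rule: finite_induct)
  case (insert x S)
  show ?case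
  \<comment> \<open>For empty \<open>S\<close> the exponent \<open>card S - 1\<close> truncates to
    0, and the identity \<open>c * c ^ (card S - 1) = c ^ card S\<close> would fail.\<close>
  proof (cases "S = {}")
    case False
    then have n: "card S > 0" using insert by (simp add: card_gt_0_iff)
    then have c: "c * c ^ (card S - 1) = c ^ card S" by (cases "card S") auto
    let ?s = "\<Sum>i\<in>S. z i"
    have s: "?s \<ge> 0" using insert by (intro sum_nonneg) auto
    have x: "z x \<ge> 0" using insert by simp
    \<comment> \<open>Only the terms of degree at most 1 in \<open>z\<close> are kept; the dropped
      product of \<open>z x\<close> with \<open>?s\<close> is nonnegative.\<close>
    have "c ^ Suc (card S) + c ^ card S * (z x + ?s) \<le> (c + z x) * (c ^ card S + c ^ (card S - 1) * ?s)"
      using s x assms(2) by (simp add: algebra_simps flip: c)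
    also have "\<dots> \<le> (c + z x) * (\<Prod>i\<in>S. c + z i)"
      using insert assms(2) by (intro mult_left_mono) auto
    finally show ?thesis using insert by simp
  qed simp
qed simp

lemma card_subsets_containing:
  "card {S::'n::finite set. card S = Suc k \<and> i \<in> S} = (CARD('n) - 1) choose k"
proof -
  have "{S::'n set. card S = Suc k \<and> i \<in> S} = insert i ` {S. S \<subseteq> UNIV - {i} \<and> card S = k}"
  proof (intro set_eqI iffI)
    fix S assume "S \<in> {S::'n set. card S = Suc k \<and> i \<in> S}"
    then show "S \<in> insert i ` {S. S \<subseteq> UNIV - {i} \<and> card S = k}"
      by (intro image_eqI[of _ _ "S - {i}"]) auto
  qed (auto simp: card_insert_if)
  moreover have "inj_on (insert i) {S. S \<subseteq> UNIV - {i} \<and> card S = k}"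
    by (rule inj_onI) (metis (mono_tags, lifting) Diff_insert_absorb insert_Diff_if mem_Collect_eq singletonI subset_Diff_insert)
  ultimately show ?thesis
    using n_subsets[of "UNIV - {i}" k] by (simp add: card_image)
qed

text \<open>Each product over a k-subset is expanded to first order in \<open>t\<close>. Every index
  lies in binom(d-1, k-1) of these subsets, whence the coefficient of the sum.\<close>

lemma esym_shift_ge:
  fixes l t :: "real^'n"
  assumes k: "1 \<le> k" and c: "c \<ge> 0" and b: "b \<ge> 0" "\<And>i. t $ i \<ge> 0"
    and l: "\<And>i. l $ i \<ge> c + b * t $ i"
  shows "c ^ k * (CARD('n) choose k) + c ^ (k - 1) * b * ((CARD('n) - 1) choose (k - 1)) * (\<Sum>i\<in>UNIV. t $ i)
    \<le> esym k l"
proof -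
  let ?A = "{S::'n set. card S = k}"
  have "(\<Sum>S\<in>?A. \<Sum>i\<in>S. t $ i) = (\<Sum>S\<in>?A. \<Sum>i\<in>UNIV. if i \<in> S then t $ i else 0)"
    by (simp add: sum.If_cases)
  also have "\<dots> = (\<Sum>i\<in>UNIV. \<Sum>S\<in>?A. if i \<in> S then t $ i else 0)" by (rule sum.swap)
  also have "\<dots> = (\<Sum>i\<in>UNIV. ((CARD('n) - 1) choose (k - 1)) * t $ i)"
  proof (rule sum.cong[OF refl])
    fix i :: 'n
    have "?A \<inter> {S. i \<in> S} = {S. card S = Suc (k - 1) \<and> i \<in> S}" using k by auto
    then show "(\<Sum>S\<in>?A. if i \<in> S then t $ i else 0) = ((CARD('n) - 1) choose (k - 1)) * t $ i"
      by (simp add: sum.If_cases card_subsets_containing)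
  qed
  finally have double: "(\<Sum>S\<in>?A. \<Sum>i\<in>S. t $ i) = ((CARD('n) - 1) choose (k - 1)) * (\<Sum>i\<in>UNIV. t $ i)"
    by (simp add: sum_distrib_left)
  have cA: "card ?A = CARD('n) choose k"
    using n_subsets[of "UNIV :: 'n set" k] by simp
  have "c ^ k * (CARD('n) choose k) + c ^ (k - 1) * b * ((CARD('n) - 1) choose (k - 1)) * (\<Sum>i\<in>UNIV. t $ i)
    = (\<Sum>S\<in>?A. c ^ k + c ^ (k - 1) * (\<Sum>i\<in>S. b * t $ i))"
    by (simp add: sum.distrib cA double mult.assoc flip: sum_distrib_left)
  also have "\<dots> \<le> (\<Sum>S\<in>?A. \<Prod>i\<in>S. c + b * t $ i)"
    using prod_shift_ge[OF _ c, of _ "\<lambda>i. b * t $ i"] b by (intro sum_mono) auto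
  also have "\<dots> \<le> esym k l"
    unfolding esym_def using l b c by (intro sum_mono prod_mono) auto
  finally show ?thesis .
qed

text \<open>The lower bounds on the entries sum to d + 2a, with d the dimension, and every partial
  derivative of \<sigma>_k at (1,...,1) is binom(d-1, k-1). The first order gain is therefore 2a
  binom(d-1, k-1), and a d^3 <= 1 lets it beat the quadratic loss.\<close>

lemma esym_gt_of_perturbation:
  fixes l t :: "real^'n"
  assumes k: "1 \<le> k" "k \<le> CARD('n)" and a: "0 < a" "a * real CARD('n) ^ 3 \<le> 1" and d: "CARD('n) \<ge> 3"
    and t: "\<And>i. t $ i \<ge> 0" "(\<Sum>i\<in>UNIV. t $ i) = 1"
    and l: "\<And>i. l $ i \<ge> 1 - a + (real CARD('n) + 2) * a * t $ i"
  shows "real (CARD('n) choose k) < esym k l"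
proof -
  define D where "D = real CARD('n)"
  define K where "K = real k"
  define C where "C = real (CARD('n) choose k)"
  have D: "D \<ge> 3" using d by (simp add: D_def)
  have K: "1 \<le> K" "K \<le> D" using k by (auto simp: K_def D_def)
  have C: "C > 0" using k by (simp add: C_def)
  have aD: "a * D ^ 3 \<le> 1" using a by (simp add: D_def)
  have "a * D \<le> a * D ^ 3"
    using a D by (intro mult_left_mono) (auto intro: self_le_power)
  then have aD1: "a * D \<le> 1" using aD by simp
  have a1: "a \<le> 1" using mult_left_mono[of 1 D a] aD1 a D by linarith
  have bin: "real ((CARD('n) - 1) choose (k - 1)) = K / D * C"
  proof -
    have "k * (CARD('n) choose k) = CARD('n) * ((CARD('n) - 1) choose (k - 1))"
      using k times_binomial_minus1_eq[of k "CARD('n)"] by simp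
    then have "real k * real (CARD('n) choose k) = real CARD('n) * real ((CARD('n) - 1) choose (k - 1))"
      by (metis of_nat_mult)
    then show ?thesis using D by (simp add: K_def D_def C_def field_simps)
  qed
  \<comment> \<open>Quadratic loss against linear gain, both divided by \<open>a\<close>. The factor
    of \<open>a\<close> is at most K (D + 1), and D (D + 1) < 2 D^3: here the cube in the smallness
    condition is spent.\<close>
  have small: "a * ((K - 1) * (K - 1 + 2 * K / D)) < 2 * K / D"
  proof -
    have "(K - 1) * (K - 1 + 2 * K / D) \<le> K * (D + 1)"
    proof (intro mult_mono)
      have "2 * K / D \<le> 2" using K D by (simp add: divide_le_eq)
      then show "K - 1 + 2 * K / D \<le> D + 1" using K by simp
    qed (use K D in auto)
    then have "a * ((K - 1) * (K - 1 + 2 * K / D)) \<le> a * (K * (D + 1))"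
      using a by (intro mult_left_mono) auto
    also have "\<dots> < 2 * K / D"
    proof -
      have "D + 1 < 2 * (D * D)"
      proof -
        have "3 * D \<le> D * D" using D by (intro mult_right_mono) auto
        then show ?thesis using D by linarith
      qed
      then have "D * (D + 1) < D * (2 * (D * D))"
        using D by (intro mult_strict_left_mono) linarith+
      then have "D * (D + 1) < 2 * D ^ 3" by (simp add: power3_eq_cube)
      then have "a * (D * (D + 1)) < a * (2 * D ^ 3)" using a by (intro mult_strict_left_mono) auto
      also have "\<dots> \<le> 2" using aD by simp
      finally have "a * (D * (D + 1)) * K < 2 * K" using K by (intro mult_strict_right_mono) auto
      then show ?thesis using D by (simp add: pos_less_divide_eq mult.commute mult.left_commute)
    qed
    finally show ?thesis .
  qed
  have "(1 - a) ^ (k - 1) \<ge> 1 + real (k - 1) * (- a)"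
    using Bernoulli_inequality[of "- a" "k - 1"] a1 by simp
  then have bern: "(1 - a) ^ (k - 1) \<ge> 1 - (K - 1) * a"
    using k by (simp add: K_def of_nat_diff algebra_simps)
  \<comment> \<open>Bernoulli has replaced (1 - a)^(k-1) by 1 - (K-1) a; of the terms linear in
    \<open>a\<close> only a E with E = 2K/D then survives.\<close>
  have "1 < (1 - (K - 1) * a) * (1 - a + (D + 2) * a * (K / D))"
  proof -
    define E where "E = 2 * K / D"
    have "(D + 2) * a * (K / D) = a * (K + E)"
      using D by (simp add: E_def field_simps)
    then have "(1 - (K - 1) * a) * (1 - a + (D + 2) * a * (K / D)) - 1
      = a * (E - a * ((K - 1) * (K - 1 + E)))"
      by (simp add: algebra_simps)
    also have "\<dots> > 0" using small a by (simp add: E_def)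
    finally show ?thesis by simp
  qed
  also have "\<dots> \<le> (1 - a) ^ (k - 1) * (1 - a + (D + 2) * a * (K / D))"
    using bern a a1 K D by (intro mult_right_mono) auto
  finally have "C * 1 < C * ((1 - a) ^ (k - 1) * (1 - a + (D + 2) * a * (K / D)))"
    using C by (intro mult_strict_left_mono)
  also have "\<dots> = (1 - a) ^ k * C + (1 - a) ^ (k - 1) * ((D + 2) * a) * (K / D * C) * 1"
    using k by (cases k) (auto simp: algebra_simps)
  also have "\<dots> \<le> esym k l"
    using esym_shift_ge[of k "1 - a" "(D + 2) * a" t l] k(1) a1 a D t l
    unfolding bin[symmetric] unfolding C_def D_def by simp
  finally show ?thesis by (simp add: C_def)
qed

subsection \<open>The maximum principle and boundary points\<close>

lemma second_derivative_le_0_at_max: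
  fixes f f' :: "real \<Rightarrow> real"
  assumes e: "e > 0" and f: "\<And>t. \<bar>t\<bar> < e \<Longrightarrow> (f has_real_derivative f' t) (at t)"
    and f': "(f' has_real_derivative D) (at 0)"
    and max: "\<And>t. \<bar>t\<bar> < e \<Longrightarrow> f t \<le> f 0"
  shows "D \<le> 0"
proof (rule ccontr)
  assume "\<not> D \<le> 0"
  then obtain d where d: "d > 0" "\<And>h. 0 < h \<Longrightarrow> h < d \<Longrightarrow> f' 0 < f' h"
    using DERIV_pos_inc_right[OF f'] by auto
  have "f' 0 = 0"
    using e max by (intro DERIV_local_max[OF f, of 0 e]) auto
  define t where "t = min d e / 2"
  have t: "0 < t" "t < d" "t < e" using d e by (auto simp: t_def)
  obtain z where z: "0 < z" "z < t" "f t - f 0 = (t - 0) * f' z"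
    using MVT2[of 0 t f f'] t f by auto
  have "f' z > 0" using d(2)[of z] z t \<open>f' 0 = 0\<close> by auto
  then have "t * f' z > 0" using t by simp
  then have "f t > f 0" using z(3) by simp
  then show False using max[of t] t by auto
qed

text \<open>A power of the squared norm is used because on a line this is the quadratic polynomial
  \<open>Q\<close>, to which the power rule applies; the bound on \<open>t\<close> keeps the line
  off the origin. For m = d/2 the last value is the second derivative of |x|^(-d) along
  \<open>q\<close>.\<close>

lemma power_barrier_line:
  fixes x q :: "'a::real_inner" and m :: real
  assumes q: "norm q = 1" and x: "x \<noteq> 0"
  defines "Q \<equiv> \<lambda>t. (norm x)\<^sup>2 + 2 * t * (x \<bullet> q) + t\<^sup>2"
  shows "(norm (x + t *\<^sub>R q))\<^sup>2 = Q t"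
    and "\<bar>t\<bar> < norm x \<Longrightarrow>
      ((\<lambda>t. Q t powr - m) has_real_derivative - m * Q t powr (- m - 1) * (2 * (x \<bullet> q) + 2 * t)) (at t)"
    and "((\<lambda>t. - m * Q t powr (- m - 1) * (2 * (x \<bullet> q) + 2 * t)) has_real_derivative
      2 * m * ((norm x)\<^sup>2) powr (- m - 1) * (2 * (m + 1) * (x \<bullet> q)\<^sup>2 / (norm x)\<^sup>2 - 1)) (at 0)"
proof -
  have qq: "q \<bullet> q = 1" using q by (simp add: norm_eq_1)
  show Q: "(norm (x + t *\<^sub>R q))\<^sup>2 = Q t" for t
    unfolding Q_def power2_norm_eq_inner
    by (simp add: inner_add_left inner_add_right qq inner_commute power2_eq_square)
  have pos: "Q t > 0" if "\<bar>t\<bar> < norm x" for t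
  proof -
    have "x + t *\<^sub>R q \<noteq> 0"
    proof
      assume "x + t *\<^sub>R q = 0"
      then have "norm x = norm (t *\<^sub>R q)" by (metis add_eq_0_iff2 norm_minus_cancel)
      then show False using that q by simp
    qed
    then show ?thesis unfolding Q[symmetric] by simp
  qed
  have dQ: "(Q has_real_derivative 2 * (x \<bullet> q) + 2 * t) (at t)" for t
    unfolding Q_def by (auto intro!: derivative_eq_intros)
  \<comment> \<open>Proved for every \<open>m\<close>, since the second derivative needs the same
    rule at \<open>m + 1\<close>.\<close>
  show d1: "((\<lambda>t. Q t powr - m) has_real_derivative - m * Q t powr (- m - 1) * (2 * (x \<bullet> q) + 2 * t)) (at t)"
    if "\<bar>t\<bar> < norm x" for t m
    using DERIV_fun_powr[OF dQ pos[OF that], of "- m"] by simp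
  have Q0: "Q 0 = (norm x)\<^sup>2" by (simp add: Q_def)
  define P where "P = Q 0 powr (- m - 1)"
  have P2: "Q 0 powr (- m - 2) = P / Q 0"
    using pos[of 0] x powr_diff[of "Q 0" "- m - 1" 1] by (simp add: P_def diff_diff_eq)
  have "((\<lambda>t. Q t powr - (m + 1)) has_real_derivative - (m + 1) * Q 0 powr (- (m + 1) - 1) * (2 * (x \<bullet> q) + 2 * 0)) (at 0)"
    using x by (intro d1) simp
  then have "((\<lambda>t. Q t powr (- m - 1)) has_real_derivative - (m + 1) * (P / Q 0) * (2 * (x \<bullet> q))) (at 0)"
    by (simp add: P2[symmetric] algebra_simps minus_diff_commute)
  moreover have "((\<lambda>t. 2 * (x \<bullet> q) + 2 * t) has_real_derivative 2) (at 0)"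
    by (auto intro!: derivative_eq_intros)
  ultimately
  have "((\<lambda>t. - m * Q t powr (- m - 1) * (2 * (x \<bullet> q) + 2 * t)) has_real_derivative
      - m * (- (m + 1) * (P / Q 0) * (2 * (x \<bullet> q))) * (2 * (x \<bullet> q) + 2 * 0) + 2 * (- m * P)) (at 0)"
    unfolding P_def by (intro DERIV_mult DERIV_cmult)
  moreover have "- m * (- (m + 1) * (P / Q 0) * (2 * (x \<bullet> q))) * (2 * (x \<bullet> q) + 2 * 0) + 2 * (- m * P)
    = 2 * m * P * (2 * (m + 1) * (x \<bullet> q)\<^sup>2 / Q 0 - 1)"
    by (simp add: algebra_simps power2_eq_square add_divide_distrib diff_divide_distrib)
  ultimately show "((\<lambda>t. - m * Q t powr (- m - 1) * (2 * (x \<bullet> q) + 2 * t)) has_real_derivative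
      2 * m * ((norm x)\<^sup>2) powr (- m - 1) * (2 * (m + 1) * (x \<bullet> q)\<^sup>2 / (norm x)\<^sup>2 - 1)) (at 0)"
    by (simp add: P_def Q0)
qed

text \<open>Taking \<sigma> = 1 for maxima of w + \<delta> b and \<sigma> = -1 for minima of w -
  \<delta> b lets both barriers share one second derivative test. The constant in w cancels from the
  comparison and is left out.\<close>

lemma hessian_at_interior_max:
  fixes u :: "real^'n \<Rightarrow> real" and m \<sigma> \<delta> :: real
  assumes S: "open S" "x \<in> S" and x: "x \<noteq> 0"
    and u: "\<And>y. y \<in> S \<Longrightarrow> (u has_derivative (\<lambda>h. g y \<bullet> h)) (at y)"
    and g: "\<And>y. y \<in> S \<Longrightarrow> (g has_derivative (\<lambda>h. H y *v h)) (at y)"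
    and q: "norm q = 1"
    and max: "\<And>y. y \<in> S \<Longrightarrow> \<sigma> * (u y - (norm y)\<^sup>2 / 2) + \<delta> * ((norm y)\<^sup>2) powr - m
      \<le> \<sigma> * (u x - (norm x)\<^sup>2 / 2) + \<delta> * ((norm x)\<^sup>2) powr - m"
  shows "\<sigma> * (q \<bullet> (H x *v q) - 1)
    + \<delta> * (2 * m * ((norm x)\<^sup>2) powr (- m - 1) * (2 * (m + 1) * (x \<bullet> q)\<^sup>2 / (norm x)\<^sup>2 - 1)) \<le> 0"
proof -
  obtain e' where e': "e' > 0" "ball x e' \<subseteq> S" using S openE by blast
  define e where "e = min e' (norm x)"
  have e: "e > 0" using e' x by (simp add: e_def)
  have inS: "x + t *\<^sub>R q \<in> S" if "\<bar>t\<bar> < e" for t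
    using that e' q by (auto simp: e_def dist_norm intro!: subsetD[OF e'(2)])
  define Q where "Q t = (norm x)\<^sup>2 + 2 * t * (x \<bullet> q) + t\<^sup>2" for t
  note line = power_barrier_line[OF q x, folded Q_def]
  have du: "((\<lambda>t. u (x + t *\<^sub>R q)) has_real_derivative g (x + t *\<^sub>R q) \<bullet> q) (at t)" if "\<bar>t\<bar> < e" for t
  proof -
    have "((\<lambda>t. u (x + t *\<^sub>R q)) has_derivative (\<lambda>h. g (x + t *\<^sub>R q) \<bullet> (h *\<^sub>R q))) (at t)"
      by (rule has_derivative_compose[where f = "\<lambda>t. x + t *\<^sub>R q", OF _ u[OF inS[OF that]]])
        (auto intro!: derivative_eq_intros)
    then show ?thesis by (rule has_derivative_imp_has_field_derivative) simp
  qed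
  have dg: "((\<lambda>t. g (x + t *\<^sub>R q) \<bullet> q) has_real_derivative q \<bullet> (H x *v q)) (at 0)"
  proof -
    have "((\<lambda>t. g (x + t *\<^sub>R q)) has_derivative (\<lambda>h. H (x + 0 *\<^sub>R q) *v (h *\<^sub>R q))) (at 0)"
      by (rule has_derivative_compose[where f = "\<lambda>t. x + t *\<^sub>R q", OF _ g[OF inS]])
        (use e in \<open>auto intro!: derivative_eq_intros\<close>)
    then have "((\<lambda>t. g (x + t *\<^sub>R q) \<bullet> q) has_derivative (\<lambda>h. (H (x + 0 *\<^sub>R q) *v (h *\<^sub>R q)) \<bullet> q)) (at 0)"
      by (rule has_derivative_inner_left)
    then show ?thesis
      by (rule has_derivative_imp_has_field_derivative) (simp add: matrix_vector_mult_scaleR inner_commute)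
  qed
  have dQ: "((\<lambda>t. Q t / 2) has_real_derivative (x \<bullet> q) + t) (at t)" for t
    unfolding Q_def by (auto intro!: derivative_eq_intros simp: field_simps)
  show ?thesis
  proof (rule second_derivative_le_0_at_max[OF e])
    let ?f' = "\<lambda>t. \<sigma> * (g (x + t *\<^sub>R q) \<bullet> q - (x \<bullet> q + t))
        + \<delta> * (- m * Q t powr (- m - 1) * (2 * (x \<bullet> q) + 2 * t))"
    show "((\<lambda>t. \<sigma> * (u (x + t *\<^sub>R q) - Q t / 2) + \<delta> * Q t powr - m) has_real_derivative ?f' t) (at t)"
      if "\<bar>t\<bar> < e" for t
      using that by (intro DERIV_add DERIV_cmult DERIV_diff du dQ line(2)) (auto simp: e_def)
    have "((\<lambda>t. g (x + t *\<^sub>R q) \<bullet> q - (x \<bullet> q + t)) has_real_derivative q \<bullet> (H x *v q) - 1) (at 0)"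
      by (rule DERIV_diff[OF dg]) (auto intro!: derivative_eq_intros)
    then show "(?f' has_real_derivative \<sigma> * (q \<bullet> (H x *v q) - 1) + \<delta> * (2 * m * ((norm x)\<^sup>2) powr (- m - 1)
        * (2 * (m + 1) * (x \<bullet> q)\<^sup>2 / (norm x)\<^sup>2 - 1))) (at 0)"
      by (intro DERIV_add DERIV_cmult line(3))
    show "\<sigma> * (u (x + t *\<^sub>R q) - Q t / 2) + \<delta> * Q t powr - m
        \<le> \<sigma> * (u (x + 0 *\<^sub>R q) - Q 0 / 2) + \<delta> * Q 0 powr - m" if "\<bar>t\<bar> < e" for t
      using max[OF inS[OF that]] line(1)[of t] line(1)[of 0] by simp
  qed
qed

text \<open>A positive value beats the limit 0 outside a large ball, so a maximum over the compact
  remainder is global; it also beats all frontier values, so it is attained off the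
  frontier.\<close>

lemma exterior_max_attained:
  fixes F :: "'a::euclidean_space \<Rightarrow> real"
  assumes \<Omega>: "open \<Omega>" and cont: "continuous_on (- \<Omega>) F" and lim: "(F \<longlongrightarrow> 0) at_infinity"
    and y: "y \<notin> \<Omega>" "F y > 0" and fr: "\<And>x. x \<in> frontier \<Omega> \<Longrightarrow> F x < F y"
  obtains x where "x \<in> - closure \<Omega>" "\<And>z. z \<notin> \<Omega> \<Longrightarrow> F z \<le> F x"
proof -
  have "\<forall>\<^sub>F x in at_infinity. dist (F x) 0 < F y" using lim y(2) by (rule tendstoD)
  then obtain R where R: "\<And>x. norm x \<ge> R \<Longrightarrow> \<bar>F x\<bar> < F y"
    by (auto simp: eventually_at_infinity)
  have yR: "norm y < R" using R[of y] y(2) by (cases "norm y < R") auto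
  let ?K = "- \<Omega> \<inter> cball 0 R"
  have "compact ?K" using \<Omega> by (intro closed_Int_compact) auto
  moreover have "y \<in> ?K" using y(1) yR by simp
  moreover have "continuous_on ?K F" using cont by (rule continuous_on_subset) auto
  ultimately obtain x where x: "x \<in> ?K" "\<And>z. z \<in> ?K \<Longrightarrow> F z \<le> F x"
    using continuous_attains_sup[of ?K F] by blast
  have xy: "F y \<le> F x" using x(2) \<open>y \<in> ?K\<close> by blast
  show ?thesis
  proof
    have "x \<notin> frontier \<Omega>" using fr[of x] xy by auto
    then show "x \<in> - closure \<Omega>" using x(1) \<Omega> by (auto simp: frontier_def interior_open)
    show "F z \<le> F x" if "z \<notin> \<Omega>" for z
    proof (cases "norm z \<le> R")
      case True then show ?thesis using x(2)[of z] that by simp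
    next
      case False then show ?thesis using R[of z] xy by simp
    qed
  qed
qed

section \<open>The outer normal and first order conditions at boundary points\<close>

lemma outer_normal_unit:
  assumes "C2_boundary_outer_normal \<Omega> \<nu>" "p \<in> frontier \<Omega>"
  shows "norm (\<nu> p) = 1"
proof -
  obtain r \<phi> g H where "r > 0" "\<forall>x\<in>ball p r. g x \<noteq> 0" "\<nu> p = (1 / norm (g p)) *\<^sub>R g p"
    using assms unfolding C2_boundary_outer_normal_def by metis
  then show ?thesis by auto
qed

text \<open>The second claim needs that the defining function vanishes at \<open>p\<close>, which the definition
  does not state.\<close>
lemma outer_normal_sides:
  fixes \<Omega> :: "(real^'n) set"
  assumes bdry: "C2_boundary_outer_normal \<Omega> \<nu>" and p: "p \<in> frontier \<Omega>" and \<Omega>: "open \<Omega>"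
  shows "h \<bullet> \<nu> p > 0 \<Longrightarrow> \<exists>d>0. \<forall>t. 0 < t \<and> t < d \<longrightarrow> p + t *\<^sub>R h \<notin> \<Omega>"
    and "h \<bullet> \<nu> p < 0 \<Longrightarrow> \<exists>d>0. \<forall>t. 0 < t \<and> t < d \<longrightarrow> p + t *\<^sub>R h \<in> \<Omega>"
proof -
  obtain r \<phi> g H where r: "r > 0" and C2: "C2_on_with (ball p r) \<phi> g H"
    and gnz: "\<forall>x\<in>ball p r. g x \<noteq> 0" and sgn: "\<And>x. x \<in> ball p r \<Longrightarrow> x \<in> \<Omega> \<longleftrightarrow> \<phi> x < 0"
    and \<nu>: "\<nu> p = (1 / norm (g p)) *\<^sub>R g p"
    using bdry p unfolding C2_boundary_outer_normal_def by metis
  have gp: "norm (g p) > 0" using gnz r by simp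
  have d\<phi>: "(\<phi> has_derivative (\<lambda>h. g p \<bullet> h)) (at p)"
    using C2 r unfolding C2_on_with_def by (metis at_within_open centre_in_ball open_ball)
  have pn: "p \<notin> \<Omega>" using p \<Omega> by (simp add: frontier_def interior_open)
  then have ge: "\<phi> p \<ge> 0" using sgn[of p] r by simp
  \<comment> \<open>A positive value would persist near \<open>p\<close>, but \<open>p\<close> is a
    limit of points of \<Omega>, where \<phi> is negative.\<close>
  have le: "\<phi> p \<le> 0"
  proof (rule ccontr)
    assume "\<not> \<phi> p \<le> 0"
    moreover have "isCont \<phi> p" using d\<phi> by (rule has_derivative_continuous)
    ultimately obtain e where e: "e > 0" "\<And>y. dist p y < e \<Longrightarrow> \<phi> y \<noteq> 0 \<and> \<bar>\<phi> y - \<phi> p\<bar> < \<phi> p"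
      using continuous_at_eps_delta[of p \<phi>]
      by (metis abs_0 abs_minus_commute diff_0_right dist_commute dist_real_def less_irrefl linorder_not_less minus_diff_eq zero_less_diff abs_of_pos)
    have "p \<in> closure \<Omega>" using p by (simp add: frontier_def)
    then obtain y where "y \<in> \<Omega>" "dist y p < min e r" using e r closure_approachable[of p \<Omega>] by (metis min_less_iff_conj)
    then show False using e(2)[of y] sgn[of y] by (auto simp: dist_commute)
  qed
  have deriv: "((\<lambda>t. \<phi> (p + t *\<^sub>R h)) has_real_derivative g p \<bullet> h) (at 0)"
  proof -
    have "((\<lambda>t. \<phi> (p + t *\<^sub>R h)) has_derivative (\<lambda>s. g p \<bullet> (s *\<^sub>R h))) (at 0)"
      by (rule has_derivative_compose[where f = "\<lambda>t. p + t *\<^sub>R h"])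
        (use d\<phi> in \<open>auto intro!: derivative_eq_intros\<close>)
    then show ?thesis by (rule has_derivative_imp_has_field_derivative) simp
  qed
  have h: "h \<bullet> \<nu> p = (g p \<bullet> h) / norm (g p)" by (simp add: \<nu> inner_commute)
  define e where "e = r / (norm h + 1)"
  have e: "e > 0" using r by (simp add: e_def add_nonneg_pos)
  have near: "p + t *\<^sub>R h \<in> ball p r" if "0 < t" "t < e" for t
  proof -
    have "t * norm h \<le> t * (norm h + 1)" using that by simp
    also have "\<dots> < r" using that by (simp add: e_def pos_less_divide_eq add_nonneg_pos)
    finally show ?thesis using that by (simp add: dist_norm)
  qed
  show "\<exists>d>0. \<forall>t. 0 < t \<and> t < d \<longrightarrow> p + t *\<^sub>R h \<notin> \<Omega>" if "h \<bullet> \<nu> p > 0"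
  proof -
    have "g p \<bullet> h > 0" using that gp unfolding h by (simp add: zero_less_divide_iff)
    then obtain d where "d > 0" "\<forall>t>0. t < d \<longrightarrow> \<phi> p < \<phi> (p + t *\<^sub>R h)"
      using DERIV_pos_inc_right[OF deriv] by auto
    then show ?thesis using e near sgn ge by (intro exI[of _ "min d e"]) force
  qed
  show "\<exists>d>0. \<forall>t. 0 < t \<and> t < d \<longrightarrow> p + t *\<^sub>R h \<in> \<Omega>" if "h \<bullet> \<nu> p < 0"
  proof -
    have "g p \<bullet> h < 0" using that gp unfolding h by (simp add: divide_less_0_iff)
    then obtain d where "d > 0" "\<forall>t>0. t < d \<longrightarrow> \<phi> (p + t *\<^sub>R h) < \<phi> p"
      using DERIV_neg_dec_right[OF deriv] by auto
    then show ?thesis using e near sgn le by (intro exI[of _ "min d e"]) force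
  qed
qed

text \<open>The derivative of \<open>v\<close> exists only within the complement of \<Omega>, so the
  test runs one-sidedly on \<open>{0..<d}\<close> along the normal, a segment that stays outside.
  The theorem gets by with this nonstrict sign, without Hopf-type strictness.\<close>

lemma normal_derivative_le_0_at_boundary_max:
  fixes \<Omega> :: "(real^'n) set"
  assumes bdry: "C2_boundary_outer_normal \<Omega> \<nu>" and p: "p \<in> frontier \<Omega>" and \<Omega>: "open \<Omega>"
    and v: "(v has_derivative (\<lambda>h. G \<bullet> h)) (at p within - \<Omega>)"
    and max: "\<And>y. y \<notin> \<Omega> \<Longrightarrow> v y \<le> (v p :: real)"
  shows "G \<bullet> \<nu> p \<le> 0"
proof (rule ccontr)
  assume pos: "\<not> ?thesis"
  have "\<nu> p \<bullet> \<nu> p > 0" using outer_normal_unit[OF bdry p] by (simp add: norm_eq_1)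
  then obtain d where d: "d > 0" "\<And>t. 0 < t \<Longrightarrow> t < d \<Longrightarrow> p + t *\<^sub>R \<nu> p \<notin> \<Omega>"
    using outer_normal_sides(1)[OF bdry p \<Omega>] by blast
  have pn: "p \<notin> \<Omega>" using p \<Omega> by (simp add: frontier_def interior_open)
  have out: "p + t *\<^sub>R \<nu> p \<notin> \<Omega>" if "t \<in> {0..<d}" for t
    using d(2)[of t] pn that by (cases "t = 0") auto
  have "((\<lambda>t. v (p + t *\<^sub>R \<nu> p)) has_derivative (\<lambda>h. G \<bullet> (h *\<^sub>R \<nu> p))) (at 0 within {0..<d})"
    by (rule has_derivative_in_compose[where f = "\<lambda>t. p + t *\<^sub>R \<nu> p"])
      (use out in \<open>auto intro!: derivative_eq_intros has_derivative_subset[OF v]\<close>)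
  then have "((\<lambda>t. v (p + t *\<^sub>R \<nu> p)) has_real_derivative G \<bullet> \<nu> p) (at 0 within {0..<d})"
    by (rule has_derivative_imp_has_field_derivative) simp
  from has_real_derivative_pos_inc_right[OF this] pos
  obtain e where e: "e > 0" "\<And>h. 0 < h \<Longrightarrow> h \<in> {0..<d} \<Longrightarrow> h < e \<Longrightarrow> v p < v (p + h *\<^sub>R \<nu> p)"
    by auto
  define t where "t = min d e / 2"
  have "0 < t" "t < d" "t < e" using d e by (auto simp: t_def)
  then show False using e(2)[of t] max[OF d(2)[of t]] by auto
qed

text \<open>If Cauchy-Schwarz were strict, h = p - |p| \<nu>(p) would point into \<Omega> and at the
  same time increase the norm. Equality is wanted only at the farthest point; at the nearest one the
  inequality itself has the right direction.\<close>

lemma normal_at_farthest_point: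
  fixes \<Omega> :: "(real^'n) set"
  assumes bdry: "C2_boundary_outer_normal \<Omega> \<nu>" and p: "p \<in> frontier \<Omega>" and \<Omega>: "open \<Omega>"
    and far: "\<And>y. y \<in> \<Omega> \<Longrightarrow> norm y \<le> norm p" and nz: "p \<noteq> 0"
  shows "p \<bullet> \<nu> p = norm p"
proof (rule ccontr)
  note n1 = outer_normal_unit[OF bdry p]
  assume "p \<bullet> \<nu> p \<noteq> norm p"
  moreover have "p \<bullet> \<nu> p \<le> norm p" using norm_cauchy_schwarz[of p "\<nu> p"] n1 by simp
  ultimately have lt: "p \<bullet> \<nu> p < norm p" by simp
  define h where "h = p - norm p *\<^sub>R \<nu> p"
  have "h \<bullet> \<nu> p < 0" using lt n1 by (simp add: h_def inner_diff_left norm_eq_1)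
  then obtain d where d: "d > 0" "\<And>t. 0 < t \<Longrightarrow> t < d \<Longrightarrow> p + t *\<^sub>R h \<in> \<Omega>"
    using outer_normal_sides(2)[OF bdry p \<Omega>] by blast
  have "norm p * (p \<bullet> \<nu> p) < norm p * norm p" using lt nz by simp
  then have ph: "p \<bullet> h > 0" by (simp add: h_def inner_diff_right dot_square_norm power2_eq_square)
  have "(norm (p + (d/2) *\<^sub>R h))\<^sup>2 = (norm p)\<^sup>2 + d * (p \<bullet> h) + (d/2)\<^sup>2 * (h \<bullet> h)"
    unfolding power2_norm_eq_inner
    by (simp add: inner_add_left inner_add_right inner_commute power2_eq_square)
  moreover have "d * (p \<bullet> h) > 0" using d ph by simp
  moreover have "(d/2)\<^sup>2 * (h \<bullet> h) \<ge> 0" by simp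
  ultimately have "(norm p)\<^sup>2 < (norm (p + (d/2) *\<^sub>R h))\<^sup>2" by linarith
  then have "norm p < norm (p + (d/2) *\<^sub>R h)" by (rule power_less_imp_less_base) simp
  then show False using far[OF d(2)[of "d/2"]] d(1) by simp
qed

subsection \<open>Barriers in the exterior domain\<close>

text \<open>\<open>C\<close> and \<open>R\<close> are explicit witnesses of the limsup condition.
  Boundary values enter the comparison lemmas below as bounds on the frontier.\<close>

locale exterior_k_hessian =
  fixes \<Omega> :: "(real^'d) set" and u :: "real^'d \<Rightarrow> real" and g :: "real^'d \<Rightarrow> real^'d"
    and H :: "real^'d \<Rightarrow> real^'d^'d" and k :: nat and c \<alpha> C R :: real
  assumes dim: "CARD('d) \<ge> 3" and k: "1 \<le> k" "k \<le> CARD('d)"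
    and \<Omega>: "open \<Omega>" "bounded \<Omega>" "0 \<in> \<Omega>"
    and C2: "C2_on_with (- \<Omega>) u g H"
    and kconv: "\<And>x. x \<in> - closure \<Omega> \<Longrightarrow> eigvals (H x) \<in> Gamma_cone k"
    and eq: "\<And>x. x \<in> - closure \<Omega> \<Longrightarrow> esym k (eigvals (H x)) = real (CARD('d) choose k)"
    and alpha: "\<alpha> > real CARD('d)"
    and decay: "\<And>x. norm x \<ge> R \<Longrightarrow> norm x powr \<alpha> * \<bar>u x - ((norm x)\<^sup>2 / 2 + c)\<bar> \<le> C"
begin

definition w :: "real^'d \<Rightarrow> real" where
  "w x = u x - ((norm x)\<^sup>2 / 2 + c)"

text \<open>$|x|^{-d}$: its Hessian has positive trace, but it decays slower than \<open>w\<close>.\<close>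
definition b :: "real^'d \<Rightarrow> real" where
  "b x = ((norm x)\<^sup>2) powr - (real CARD('d) / 2)"

lemma b_pos: "x \<noteq> 0 \<Longrightarrow> b x > 0"
  by (simp add: b_def)

lemma b_eq: "b x = norm x powr - real CARD('d)"
  by (cases "x = 0") (simp_all add: b_def powr_powr flip: powr_numeral)

lemma b_antimono:
  assumes "x \<noteq> 0" "norm x \<le> norm y"
  shows "b y \<le> b x"
  unfolding b_eq using assms by (intro powr_mono2') auto

lemma w_bound:
  assumes "norm x \<ge> R" "norm x > 0"
  shows "\<bar>w x\<bar> \<le> \<bar>C\<bar> * norm x powr - \<alpha>"
proof -
  have "norm x powr - \<alpha> * (norm x powr \<alpha> * \<bar>w x\<bar>) \<le> norm x powr - \<alpha> * C"
    using decay[OF assms(1)] by (intro mult_left_mono) (simp_all add: w_def)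
  moreover have "norm x powr - \<alpha> * (norm x powr \<alpha> * \<bar>w x\<bar>) = \<bar>w x\<bar>"
    using assms by (simp add: powr_minus)
  moreover have "norm x powr - \<alpha> * C \<le> norm x powr - \<alpha> * \<bar>C\<bar>"
    by (intro mult_left_mono) auto
  ultimately show ?thesis by (simp add: mult.commute)
qed

lemma norm_powr_tendsto_0:
  assumes "\<beta> > 0"
  shows "((\<lambda>x::real^'d. norm x powr - \<beta>) \<longlongrightarrow> 0) at_infinity"
  using assms by (intro tendsto_neg_powr filterlim_norm_at_top) auto

lemma w_tendsto_0: "(w \<longlongrightarrow> 0) at_infinity"
proof (rule Lim_null_comparison)
  show "((\<lambda>x::real^'d. \<bar>C\<bar> * norm x powr - \<alpha>) \<longlongrightarrow> 0) at_infinity"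
    using alpha by (intro tendsto_mult_right_zero norm_powr_tendsto_0) linarith
  show "\<forall>\<^sub>F x in at_infinity. norm (w x) \<le> \<bar>C\<bar> * norm x powr - \<alpha>"
    unfolding eventually_at_infinity
  proof (intro exI[of _ "max R 1"] allI impI)
    fix x :: "real^'d" assume "max R 1 \<le> norm x"
    then have "\<bar>w x\<bar> \<le> \<bar>C\<bar> * norm x powr - \<alpha>" by (intro w_bound) linarith+
    then show "norm (w x) \<le> \<bar>C\<bar> * norm x powr - \<alpha>" by simp
  qed
qed

lemma b_tendsto_0: "(b \<longlongrightarrow> 0) at_infinity"
  unfolding b_eq[abs_def] by (rule norm_powr_tendsto_0) simp

text \<open>On large spheres |w| <= |C| |x|^(-\<beta>) b with the surplus \<beta> = \<alpha> - d >
  0. Hence neither w <= -\<delta> b nor w >= \<delta> b can hold throughout the exterior.\<close>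

lemma barrier_not_below_w:
  assumes "\<delta> > 0"
  shows "\<exists>y. y \<notin> \<Omega> \<and> \<bar>w y\<bar> < \<delta> * b y"
proof -
  obtain B where B: "\<And>x. x \<in> \<Omega> \<Longrightarrow> norm x \<le> B" using \<Omega>(2) by (auto simp: bounded_iff)
  define \<beta> where "\<beta> = \<alpha> - real CARD('d)"
  have "((\<lambda>x::real^'d. \<bar>C\<bar> * norm x powr - \<beta>) \<longlongrightarrow> 0) at_infinity"
    using alpha by (intro tendsto_mult_right_zero norm_powr_tendsto_0) (simp add: \<beta>_def)
  then have "\<forall>\<^sub>F x::real^'d in at_infinity. \<bar>C\<bar> * norm x powr - \<beta> < \<delta>"
    using assms by (rule order_tendstoD)
  then obtain R' where R': "\<And>x::real^'d. norm x \<ge> R' \<Longrightarrow> \<bar>C\<bar> * norm x powr - \<beta> < \<delta>"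
    by (auto simp: eventually_at_infinity)
  \<comment> \<open>\<open>B + 1\<close> puts the sphere outside \<Omega>, and 1 makes its radius
    positive.\<close>
  define r where "r = Max {R, R', B + 1, 1}"
  have r: "r \<ge> R" "r \<ge> R'" "r \<ge> B + 1" "r \<ge> 1" by (auto simp: r_def)
  obtain y :: "real^'d" where y: "norm y = r" using vector_choose_size[of r] r by auto
  have "\<bar>w y\<bar> \<le> \<bar>C\<bar> * norm y powr - \<alpha>" using r y by (intro w_bound) auto
  also have "norm y powr - \<alpha> = norm y powr - \<beta> * b y"
    unfolding b_eq by (simp add: \<beta>_def flip: powr_add)
  also have "\<bar>C\<bar> * (norm y powr - \<beta> * b y) < \<delta> * b y"
    unfolding mult.assoc[symmetric]
  proof (rule mult_strict_right_mono)
    show "\<bar>C\<bar> * norm y powr - \<beta> < \<delta>" using R' r y by blast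
    have "norm y > 0" using r y by linarith
    then show "b y > 0" by (intro b_pos) simp
  qed
  finally show ?thesis using B[of y] r y by (intro exI[of _ y]) auto
qed

lemma u_deriv: "x \<notin> \<Omega> \<Longrightarrow> (u has_derivative (\<lambda>h. g x \<bullet> h)) (at x within - \<Omega>)"
  using C2 by (auto simp: C2_on_with_def)

lemma w_deriv:
  assumes "x \<notin> \<Omega>"
  shows "(w has_derivative (\<lambda>h. (g x - x) \<bullet> h)) (at x within - \<Omega>)"
  unfolding w_def[abs_def] power2_norm_eq_inner inner_diff_left
  by (auto intro!: derivative_eq_intros u_deriv[OF assms] simp: inner_commute)

lemma interior_derivs:
  assumes "x \<in> - closure \<Omega>"
  shows "(u has_derivative (\<lambda>h. g x \<bullet> h)) (at x)" "(g has_derivative (\<lambda>h. H x *v h)) (at x)"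
proof -
  have "x \<in> interior (- \<Omega>)" using assms by (simp add: interior_complement)
  then have "at x within - \<Omega> = at x" by (rule at_within_interior)
  moreover have "x \<in> - \<Omega>" using assms closure_subset by blast
  ultimately show "(u has_derivative (\<lambda>h. g x \<bullet> h)) (at x)" "(g has_derivative (\<lambda>h. H x *v h)) (at x)"
    using C2 unfolding C2_on_with_def by metis+
qed

lemma hessian_sym:
  assumes "x \<in> - closure \<Omega>"
  shows "transpose (H x) = H x"
proof (rule hessian_symmetric[OF _ assms interior_derivs])
  show "continuous_on (- closure \<Omega>) H"
    using C2 closure_subset[of \<Omega>] unfolding C2_on_with_def
    by (meson Compl_anti_mono continuous_on_subset)
qed auto

text \<open>At an interior maximum of \<open>\<sigma> w + \<delta> b\<close>, the second derivative test along the eigenvectors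
  of the Hessian turns into one-sided bounds on its eigenvalues.\<close>
lemma barrier_comparison:
  assumes \<delta>: "\<delta> > 0" and B: "B \<ge> 0" and fr: "\<And>x. x \<in> frontier \<Omega> \<Longrightarrow> \<sigma> * w x + \<delta> * b x \<le> B"
    and y: "y \<notin> \<Omega>" "\<sigma> * w y + \<delta> * b y > B"
  obtains x t where "x \<in> - closure \<Omega>" "x \<noteq> 0" "\<And>i. t $ i \<ge> 0" "(\<Sum>i\<in>UNIV. t $ i) = 1"
    "\<And>i. \<sigma> * (eigvals (H x) $ i - 1) + \<delta> * (real CARD('d) * ((norm x)\<^sup>2) powr (- (real CARD('d) / 2) - 1)
      * ((real CARD('d) + 2) * t $ i - 1)) \<le> 0"
proof -
  define F where "F x = \<sigma> * w x + \<delta> * b x" for x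
  have nz: "x \<noteq> 0" if "x \<notin> \<Omega>" for x using \<Omega>(3) that by auto
  have "continuous_on (- \<Omega>) w"
    using w_deriv by (intro has_derivative_continuous_on) auto
  moreover have "continuous_on (- \<Omega>) b"
    unfolding b_eq[abs_def] using nz by (intro continuous_intros) auto
  ultimately have cont: "continuous_on (- \<Omega>) F"
    unfolding F_def[abs_def] by (intro continuous_intros)
  have "(F \<longlongrightarrow> \<sigma> * 0 + \<delta> * 0) at_infinity"
    unfolding F_def[abs_def] by (intro tendsto_intros w_tendsto_0 b_tendsto_0)
  then have lim: "(F \<longlongrightarrow> 0) at_infinity" by simp
  \<comment> \<open>\<open>B \<ge> 0\<close> lifts the value at \<open>y\<close> above the limit 0,
    so the maximum does not escape to infinity; \<open>fr\<close> keeps it off the frontier.\<close>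
  obtain x where x: "x \<in> - closure \<Omega>" and max: "\<And>z. z \<notin> \<Omega> \<Longrightarrow> F z \<le> F x"
  proof (rule exterior_max_attained[OF \<Omega>(1) cont lim y(1)])
    show "F y > 0" using y(2) B by (simp add: F_def)
    show "F z < F y" if "z \<in> frontier \<Omega>" for z
      using fr[OF that] y(2) by (simp add: F_def)
  qed auto
  have out: "z \<notin> \<Omega>" if "z \<in> - closure \<Omega>" for z using that closure_subset by blast
  have x0: "x \<noteq> 0" using nz out x by blast
  obtain q where q: "\<And>i. norm (q i) = 1" "\<And>i. q i \<bullet> (H x *v q i) = eigvals (H x) $ i"
    "\<And>z. (\<Sum>i\<in>UNIV. (z \<bullet> q i)\<^sup>2) = (norm z)\<^sup>2"
    using eigvals_orthonormal[OF hessian_sym[OF x]] by metis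
  \<comment> \<open>Squared direction cosines of \<open>x\<close> in the eigenframe, in which the
    diagonal entries of the Hessian of \<open>b\<close> are d |x|^(-d-2) ((d+2) t_i - 1).\<close>
  define t :: "real^'d" where "t = (\<chi> i. (x \<bullet> q i)\<^sup>2 / (norm x)\<^sup>2)"
  have sum1: "(\<Sum>i\<in>UNIV. t $ i) = 1"
    using q(3)[of x] x0 by (simp add: t_def flip: sum_divide_distrib)
  have bound: "\<sigma> * (q i \<bullet> (H x *v q i) - 1) + \<delta> * (2 * (real CARD('d) / 2) * ((norm x)\<^sup>2) powr (- (real CARD('d) / 2) - 1)
      * (2 * (real CARD('d) / 2 + 1) * (x \<bullet> q i)\<^sup>2 / (norm x)\<^sup>2 - 1)) \<le> 0" for i
  proof (rule hessian_at_interior_max[OF _ x x0 interior_derivs q(1)])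
    fix z assume "z \<in> - closure \<Omega>"
    then show "\<sigma> * (u z - (norm z)\<^sup>2 / 2) + \<delta> * ((norm z)\<^sup>2) powr - (real CARD('d) / 2)
      \<le> \<sigma> * (u x - (norm x)\<^sup>2 / 2) + \<delta> * ((norm x)\<^sup>2) powr - (real CARD('d) / 2)"
      using max[OF out] by (simp add: F_def w_def b_def algebra_simps)
  qed auto
  show ?thesis
  proof
    show "t $ i \<ge> 0" for i by (simp add: t_def)
    show "\<sigma> * (eigvals (H x) $ i - 1) + \<delta> * (real CARD('d) * ((norm x)\<^sup>2) powr (- (real CARD('d) / 2) - 1)
      * ((real CARD('d) + 2) * t $ i - 1)) \<le> 0" for i
      using bound[of i] by (simp add: q(2) t_def add.commute)
  qed (fact x x0 sum1)+
qed

text \<open>The eigenvalue bounds sum to d - 2a with a = \<delta> d |x|^(-d-2), below what Maclaurin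
  allows. That inequality holds on the whole cone, so any \<delta> > 0 will do.\<close>

lemma w_upper:
  assumes \<delta>: "\<delta> > 0" and B: "B \<ge> 0" and fr: "\<And>x. x \<in> frontier \<Omega> \<Longrightarrow> w x + \<delta> * b x \<le> B"
    and y: "y \<notin> \<Omega>"
  shows "w y + \<delta> * b y \<le> B"
proof (rule ccontr)
  assume "\<not> ?thesis"
  then obtain x t where x: "x \<in> - closure \<Omega>" "x \<noteq> 0" and t: "(\<Sum>i\<in>UNIV. t $ i) = 1"
    and l: "\<And>i. 1 * (eigvals (H x) $ i - 1) + \<delta> * (real CARD('d) * ((norm x)\<^sup>2) powr (- (real CARD('d) / 2) - 1)
      * ((real CARD('d) + 2) * t $ i - 1)) \<le> 0"
    using barrier_comparison[OF \<delta> B, of 1 y] fr y by (metis mult_1 not_le)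
  define a where "a = \<delta> * (real CARD('d) * ((norm x)\<^sup>2) powr (- (real CARD('d) / 2) - 1))"
  have a: "a > 0" using \<delta> x by (simp add: a_def)
  have "eigvals (H x) $ i \<le> 1 + a - a * (real CARD('d) + 2) * t $ i" for i
    using l[of i] by (simp add: a_def algebra_simps)
  then have "(\<Sum>i\<in>UNIV. eigvals (H x) $ i) \<le> (\<Sum>i\<in>UNIV. 1 + a - a * (real CARD('d) + 2) * t $ i)"
    by (rule sum_mono)
  also have "\<dots> = real CARD('d) * (1 + a) - a * (real CARD('d) + 2)"
    by (simp add: sum_subtractf t flip: sum_distrib_left)
  also have "\<dots> < real CARD('d)" using a by (simp add: algebra_simps)
  finally show False
    using maclaurin_Gamma_cone[OF k kconv eq] x(1) by fastforce
qed

text \<open>Here a = \<delta> d |x|^(-d-2) must satisfy a d^3 <= 1 at a touching point of unknown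
  position; |x| >= \<rho> outside \<Omega> lets one \<delta> serve everywhere. The exponent 4 is
  this cube and the factor d inside a.\<close>

lemma w_lower:
  assumes \<delta>: "\<delta> > 0" and \<rho>: "\<rho> > 0" "ball 0 \<rho> \<subseteq> \<Omega>"
    and small: "\<delta> * (real CARD('d) ^ 4 * (\<rho>\<^sup>2) powr (- (real CARD('d) / 2) - 1)) \<le> 1"
    and B: "B \<ge> 0" and fr: "\<And>x. x \<in> frontier \<Omega> \<Longrightarrow> \<delta> * b x - w x \<le> B"
    and y: "y \<notin> \<Omega>"
  shows "\<delta> * b y - w y \<le> B"
proof (rule ccontr)
  assume neg: "\<not> ?thesis"
  have fr': "- 1 * w x + \<delta> * b x \<le> B" if "x \<in> frontier \<Omega>" for x using fr[OF that] by simp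
  obtain x t where x: "x \<in> - closure \<Omega>" "x \<noteq> 0" and t: "\<And>i. t $ i \<ge> 0" "(\<Sum>i\<in>UNIV. t $ i) = 1"
    and l: "\<And>i. - 1 * (eigvals (H x) $ i - 1) + \<delta> * (real CARD('d) * ((norm x)\<^sup>2) powr (- (real CARD('d) / 2) - 1)
      * ((real CARD('d) + 2) * t $ i - 1)) \<le> 0"
    by (rule barrier_comparison[OF \<delta> B fr' y]) (use neg in auto)
  define a where "a = \<delta> * (real CARD('d) * ((norm x)\<^sup>2) powr (- (real CARD('d) / 2) - 1))"
  have a: "a > 0" using \<delta> x by (simp add: a_def)
  have "x \<notin> ball 0 \<rho>" using x(1) \<rho>(2) closure_subset[of \<Omega>] by blast
  then have "\<rho> \<le> norm x" by simp
  then have "((norm x)\<^sup>2) powr (- (real CARD('d) / 2) - 1) \<le> (\<rho>\<^sup>2) powr (- (real CARD('d) / 2) - 1)"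
    using \<rho> by (intro powr_mono2') auto
  then have "\<delta> * (real CARD('d) ^ 4 * ((norm x)\<^sup>2) powr (- (real CARD('d) / 2) - 1)) \<le> 1"
    using \<delta> by (intro order_trans[OF _ small] mult_left_mono) auto
  then have a1: "a * real CARD('d) ^ 3 \<le> 1"
    by (simp add: a_def power3_eq_cube power4_eq_xxxx mult_ac)
  have "eigvals (H x) $ i \<ge> 1 - a + (real CARD('d) + 2) * a * t $ i" for i
    using l[of i] by (simp add: a_def algebra_simps)
  then have "real (CARD('d) choose k) < esym k (eigvals (H x))"
    using esym_gt_of_perturbation[OF k a a1 dim t] by blast
  then show False using eq[OF x(1)] by simp
qed

end

theorem theorem1p15:
  fixes \<Omega> :: "(real^'d) set" and \<nu> :: "real^'d \<Rightarrow> real^'d"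
    and u :: "real^'d \<Rightarrow> real" and k :: nat and c \<alpha> :: real
  assumes dim: "CARD('d) \<ge> 3"
    and k: "2 \<le> k" "k \<le> CARD('d) - 1"
    and dom: "open \<Omega>" "connected \<Omega>" "bounded \<Omega>" "\<Omega> \<noteq> {}"
    and bdry: "C2_boundary_outer_normal \<Omega> \<nu>"
    and star: "0 \<in> \<Omega>" "\<forall>x\<in>\<Omega>. closed_segment 0 x \<subseteq> \<Omega>"
    and c: "c < 0" and alpha: "\<alpha> > real CARD('d)"
    and C2: "C2_on_with (- \<Omega>) u g H"
    and kconv: "\<forall>x \<in> - closure \<Omega>. eigvals (H x) \<in> Gamma_cone k"
    and eq: "\<forall>x \<in> - closure \<Omega>. esym k (eigvals (H x)) = real (CARD('d) choose k)"
    and bc0: "\<forall>x \<in> frontier \<Omega>. u x = 0"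
    and bc1: "\<forall>x \<in> frontier \<Omega>. g x \<bullet> \<nu> x = 1"
    and asym: "Limsup at_infinity
                 (\<lambda>x. ereal (norm x powr \<alpha> * \<bar>u x - ((1/2) * (norm x)\<^sup>2 + c)\<bar>)) < \<infinity>"
  shows "\<Omega> = ball 0 1 \<and> (\<forall>x \<in> - \<Omega>. u x = (1/2) * (norm x)\<^sup>2 - 1/2)"
proof -
  obtain C :: real where "Limsup at_infinity
      (\<lambda>x. ereal (norm x powr \<alpha> * \<bar>u x - ((1/2) * (norm x)\<^sup>2 + c)\<bar>)) < ereal C"
    using asym ereal_dense2 by blast
  then have "\<forall>\<^sub>F x in at_infinity. ereal (norm x powr \<alpha> * \<bar>u x - ((1/2) * (norm x)\<^sup>2 + c)\<bar>) < ereal C"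
    by (rule Limsup_lessD)
  then obtain R where R: "\<And>x. norm x \<ge> R \<Longrightarrow> norm x powr \<alpha> * \<bar>u x - ((norm x)\<^sup>2 / 2 + c)\<bar> < C"
    by (auto simp: eventually_at_infinity)
  interpret exterior_k_hessian \<Omega> u g H k c \<alpha> C R
    using dim k dom star(1) C2 kconv eq alpha R by unfold_locales (auto intro: less_imp_le)

  \<comment> \<open>Nearest and farthest boundary points\<close>
  have frO: "x \<notin> \<Omega>" if "x \<in> frontier \<Omega>" for x
    using that dom(1) by (simp add: frontier_def interior_open)
  have fr0: "x \<noteq> 0" if "x \<in> frontier \<Omega>" for x using frO[OF that] star(1) by auto
  have wfr: "w x = - (norm x)\<^sup>2 / 2 - c" if "x \<in> frontier \<Omega>" for x
    using bc0 that by (simp add: w_def)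
  have clc: "compact (closure \<Omega>)" using dom(3) by simp
  obtain x1 where x1c: "x1 \<in> closure \<Omega>" and far: "\<And>y. y \<in> closure \<Omega> \<Longrightarrow> norm y \<le> norm x1"
    using continuous_attains_sup[OF clc _ continuous_on_norm[OF continuous_on_id]] dom(4) by auto
  have "x1 \<notin> \<Omega>"
  proof
    assume "x1 \<in> \<Omega>"
    then obtain e where e: "e > 0" "cball x1 e \<subseteq> \<Omega>" using dom(1) open_contains_cball by blast
    \<comment> \<open>The sign of \<open>v\<close> is chosen so that moving by \<open>v\<close>
      increases the norm, even if \<open>x1\<close> were the origin.\<close>
    obtain v :: "real^'d" where v: "norm v = e" "x1 \<bullet> v \<ge> 0"
    proof -
      obtain v0 :: "real^'d" where v0: "norm v0 = e" using vector_choose_size[of e] e(1) by auto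
      show thesis using that[of v0] that[of "- v0"] v0 by (cases "x1 \<bullet> v0 \<ge> 0") auto
    qed
    have "x1 + v \<in> \<Omega>" using e v by (intro subsetD[OF e(2)]) (simp add: dist_norm)
    then have "norm (x1 + v) \<le> norm x1" using far closure_subset by blast
    then have "(norm (x1 + v))\<^sup>2 \<le> (norm x1)\<^sup>2" by (intro power_mono) auto
    moreover have "(norm (x1 + v))\<^sup>2 = (norm x1)\<^sup>2 + 2 * (x1 \<bullet> v) + e\<^sup>2"
      unfolding v(1)[symmetric] power2_norm_eq_inner
      by (simp add: inner_add_left inner_add_right inner_commute)
    moreover have "e\<^sup>2 > 0" using e by simp
    ultimately show False using v(2) by linarith
  qed
  then have x1: "x1 \<in> frontier \<Omega>" using x1c dom(1) by (simp add: frontier_def interior_open)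
  have fr_far: "norm x \<le> norm x1" if "x \<in> frontier \<Omega>" for x
    using far[of x] that by (simp add: frontier_def)
  have "compact (frontier \<Omega>)" using dom(3) by (rule compact_frontier_bounded)
  then obtain x0 where x0: "x0 \<in> frontier \<Omega>" and near: "\<And>x. x \<in> frontier \<Omega> \<Longrightarrow> norm x0 \<le> norm x"
    using continuous_attains_inf[of "frontier \<Omega>" norm] x1 continuous_on_norm[OF continuous_on_id] by blast
  \<comment> \<open>A connected ball that meets \<Omega> but leaves it would contain a frontier
    point nearer than \<open>x0\<close>.\<close>
  have ball: "ball 0 (norm x0) \<subseteq> \<Omega>"
  proof (rule ccontr)
    assume "\<not> ?thesis"
    then have "ball 0 (norm x0) - \<Omega> \<noteq> {}" by blast
    moreover have "0 \<in> ball 0 (norm x0) \<inter> \<Omega>" using star(1) fr0[OF x0] by simp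
    ultimately obtain z where "z \<in> ball 0 (norm x0)" "z \<in> frontier \<Omega>"
      using connected_Int_frontier[OF connected_ball, of 0 "norm x0" \<Omega>] by blast
    then show False using near[of z] by simp
  qed
  have b0: "b x0 > 0" by (rule b_pos[OF fr0[OF x0]])
  have bfr: "b x \<le> b x0" if "x \<in> frontier \<Omega>" for x by (rule b_antimono[OF fr0[OF x0] near[OF that]])
  have wle: "w x \<le> w x0" if "x \<in> frontier \<Omega>" for x
    using power_mono[OF near[OF that], of 2] wfr[OF that] wfr[OF x0] by simp
  have wge: "w x1 \<le> w x" if "x \<in> frontier \<Omega>" for x
    using power_mono[OF fr_far[OF that], of 2] wfr[OF that] wfr[OF x1] by simp

  \<comment> \<open>Bounds for w by its extreme boundary values\<close>
  have w0: "w x0 \<ge> 0"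
  proof (rule ccontr)
    assume neg: "\<not> ?thesis"
    \<comment> \<open>Brings the frontier maximum of w + \<delta> b to exactly 0, the least bound
      \<open>w_upper\<close> accepts; then w <= -\<delta> b outside, against the decay.\<close>
    define \<delta> where "\<delta> = - w x0 / b x0"
    have \<delta>: "\<delta> > 0" using neg b0 by (simp add: \<delta>_def divide_neg_pos)
    have "w x + \<delta> * b x \<le> 0" if "x \<in> frontier \<Omega>" for x
    proof -
      have "w x + \<delta> * b x \<le> w x0 + \<delta> * b x0"
        using wle[OF that] bfr[OF that] \<delta> by (intro add_mono mult_left_mono) auto
      then show ?thesis using b0 by (simp add: \<delta>_def)
    qed
    then have "w y + \<delta> * b y \<le> 0" if "y \<notin> \<Omega>" for y using w_upper[OF \<delta>, of 0 y] that by simp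
    then show False using barrier_not_below_w[OF \<delta>] by fastforce
  qed
  have upper: "w y \<le> w x0" if y: "y \<notin> \<Omega>" for y
  proof (rule field_le_epsilon)
    fix e :: real assume e: "e > 0"
    \<comment> \<open>The barrier then adds at most \<open>e\<close> on the frontier, and
      \<open>w0\<close> makes the bound \<open>w x0 + e\<close> admissible.\<close>
    define \<delta> where "\<delta> = e / b x0"
    have \<delta>: "\<delta> > 0" using e b0 by (simp add: \<delta>_def)
    have "w x + \<delta> * b x \<le> w x0 + e" if "x \<in> frontier \<Omega>" for x
    proof -
      have "w x + \<delta> * b x \<le> w x0 + \<delta> * b x0"
        using wle[OF that] bfr[OF that] \<delta> by (intro add_mono mult_left_mono) auto
      then show ?thesis using b0 by (simp add: \<delta>_def)
    qed
    then have "w y + \<delta> * b y \<le> w x0 + e" using w_upper[OF \<delta>, of "w x0 + e" y] y w0 e by simp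
    moreover have "\<delta> * b y \<ge> 0" using \<delta> by (simp add: b_def)
    ultimately show "w y \<le> w x0 + e" by linarith
  qed

  define K where "K = real CARD('d) ^ 4 * ((norm x0)\<^sup>2) powr (- (real CARD('d) / 2) - 1)"
  have K: "K > 0" using fr0[OF x0] by (simp add: K_def)
  have lower: "\<exists>\<delta>>0. \<forall>y. y \<notin> \<Omega> \<longrightarrow> \<delta> * b y - w y \<le> e - w x1"
    if e: "e > 0" "e - w x1 \<ge> 0" for e
  proof -
    \<comment> \<open>The first entry is the smallness condition of \<open>w_lower\<close> with
      \<rho> = |x0|; the second keeps the barrier below \<open>e\<close> on the frontier.\<close>
    define \<delta> where "\<delta> = min (1 / K) (e / b x0)"
    have \<delta>: "\<delta> > 0" using K e b0 by (simp add: \<delta>_def)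
    have small: "\<delta> * K \<le> 1"
    proof -
      have "\<delta> * K \<le> 1 / K * K" using K by (intro mult_right_mono) (auto simp: \<delta>_def)
      then show ?thesis using K by simp
    qed
    have "\<delta> * b x - w x \<le> e - w x1" if "x \<in> frontier \<Omega>" for x
    proof -
      have "\<delta> * b x \<le> e / b x0 * b x0"
        using bfr[OF that] \<delta> e b0 by (intro mult_mono) (auto simp: \<delta>_def b_def)
      then show ?thesis using wge[OF that] b0 by simp
    qed
    then show ?thesis
      using w_lower[OF \<delta> _ ball small[unfolded K_def] e(2)] \<delta> fr0[OF x0] by auto
  qed
  have w1: "w x1 \<le> 0"
  proof (rule ccontr)
    assume "\<not> ?thesis"
    \<comment> \<open>The choice \<open>e = w x1\<close> gives the bound 0, so w >= \<delta> b
      outside, again against the decay.\<close>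
    then obtain \<delta> where \<delta>: "\<delta> > 0" "\<And>y. y \<notin> \<Omega> \<Longrightarrow> \<delta> * b y - w y \<le> w x1 - w x1"
      using lower[of "w x1"] by auto
    then show False using barrier_not_below_w[OF \<delta>(1)] by fastforce
  qed
  have lower': "w x1 \<le> w y" if y: "y \<notin> \<Omega>" for y
  proof (rule field_le_epsilon)
    fix e :: real assume e: "e > 0"
    obtain \<delta> where \<delta>: "\<delta> > 0" "\<delta> * b y - w y \<le> e - w x1"
      using lower[OF e] w1 e y by auto
    moreover have "\<delta> * b y \<ge> 0" using \<delta> by (simp add: b_def)
    ultimately show "w x1 \<le> w y + e" by linarith
  qed

  \<comment> \<open>Normal derivatives at the extreme points and rigidity\<close>
  have "(g x0 - x0) \<bullet> \<nu> x0 \<le> 0"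
    using normal_derivative_le_0_at_boundary_max[OF bdry x0 dom(1) w_deriv[OF frO[OF x0]]] upper by blast
  then have "1 \<le> x0 \<bullet> \<nu> x0" using bc1 x0 by (simp add: inner_diff_left)
  also have "\<dots> \<le> norm x0"
    using norm_cauchy_schwarz[of x0 "\<nu> x0"] outer_normal_unit[OF bdry x0] by simp
  finally have r0: "1 \<le> norm x0" .
  have "((\<lambda>x. - w x) has_derivative (\<lambda>h. (x1 - g x1) \<bullet> h)) (at x1 within - \<Omega>)"
    using has_derivative_minus[OF w_deriv[OF frO[OF x1]]] by (simp add: inner_diff_left)
  then have "(x1 - g x1) \<bullet> \<nu> x1 \<le> 0"
    using normal_derivative_le_0_at_boundary_max[OF bdry x1 dom(1)] lower' by simp
  then have "x1 \<bullet> \<nu> x1 \<le> 1" using bc1 x1 by (simp add: inner_diff_left)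
  moreover have "x1 \<bullet> \<nu> x1 = norm x1"
    using normal_at_farthest_point[OF bdry x1 dom(1) _ fr0[OF x1]] far closure_subset by blast
  ultimately have r1: "norm x1 \<le> 1" by simp
  have n: "norm x0 = 1" "norm x1 = 1" using r0 r1 near[OF x1] by linarith+
  have "\<Omega> \<subseteq> cball 0 1"
  proof
    fix y assume "y \<in> \<Omega>"
    then have "norm y \<le> norm x1" using far closure_subset by blast
    then show "y \<in> cball 0 1" using n by simp
  qed
  then have "\<Omega> \<subseteq> ball 0 1" using interior_maximal[OF _ dom(1)] interior_cball by metis
  then have O: "\<Omega> = ball 0 1" using ball n by auto
  \<comment> \<open>With both norms equal to 1, \<open>w x0\<close> and \<open>w x1\<close> are the
    same number -1/2 - c, squeezed to 0 by \<open>w0\<close> and \<open>w1\<close>.\<close>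
  have c': "c = - 1 / 2" using w0 w1 wfr[OF x0] wfr[OF x1] n by simp
  have "u y = (1/2) * (norm y)\<^sup>2 - 1/2" if "y \<in> - \<Omega>" for y
  proof -
    have "w y = 0"
      using upper[of y] lower'[of y] that wfr[OF x0] wfr[OF x1] n c' by simp
    then have "u y - ((norm y)\<^sup>2 / 2 + c) = 0" by (simp only: w_def)
    then show ?thesis using c' by simp
  qed
  then show ?thesis using O by blast
qed

end
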